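(* Let $D\in\mathbb{N}$, let $\boldsymbol{d}=(d_1,\dots,d_D)\in\mathbb{N}^D$ be a spatial dimension, $c_1,c_2\in\mathbb{N}$ channel sizes, $K\subset\mathbb{R}^{c_1\times\boldsymbol{d}}$ a compact set, $2\boldsymbol{k}+1=(2k_1+1,\dots,2k_D+1)\in\mathbb{N}^D$ a kernel size with $2k_i+1\ge 3$ for every $i\in\{1,\dots,D\}$, and $\sigma:\mathbb{R}\to\mathbb{R}$ a non-affine continuous activation function such that there exist $\alpha\in\mathbb{R}$ and $\epsilon>0$ for which $\sigma$ is $C^1$ on $(\alpha-\epsilon,\alpha+\epsilon)$ and $\sigma'(\alpha)\neq 0$. Then $$\overline{\Delta^{\sigma,\boldsymbol{d},2\boldsymbol{k}+1}_{c_1,c_2,c_1+c_2+2}}=C(K,\mathbb{R}^{c_2\times\boldsymbol{d}}).$$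
   Context: $\mathbb{N}=\{1,2,\dots\}$; $C(X,Y)$ is the set of continuous functions from $X$ to $Y$. For $\boldsymbol{d}=(d_1,\dots,d_D)\in\mathbb{N}^D$, $\mathbb{R}^{\boldsymbol{d}}=\mathbb{R}^{d_1\times\cdots\times d_D}$ with entries $x_{\boldsymbol{i}}$, $\boldsymbol{i}\in\prod_{t=1}^D\{1,\dots,d_t\}$, and $\mathbb{R}^{c\times\boldsymbol{d}}$ consists of $x=(x^1,\dots,x^c)$ with channels $x^i\in\mathbb{R}^{\boldsymbol{d}}$. $\boldsymbol{1}_{\boldsymbol{d}}\in\mathbb{R}^{\boldsymbol{d}}$ is the all-ones tensor. Inequalities and absolute values of multi-indices are componentwise. Zero-padding convolution: for $\boldsymbol{k}=(k_1,\dots,k_D)$, a kernel $w=(w_{\boldsymbol{j}})_{|\boldsymbol{j}|\le\boldsymbol{k}}\in\mathbb{R}^{2\boldsymbol{k}+1}$ and $x\in\mathbb{R}^{\boldsymbol{d}}$, $w\circledast x\in\mathbb{R}^{\boldsymbol{d}}$ is given by $(w\circledast x)_{\boldsymbol{i}}=\sum_{|\boldsymbol{j}|\le\boldsymbol{k}}w_{\boldsymbol{j}}x_{\boldsymbol{i}-\boldsymbol{j}}$, where $x_{\boldsymbol{m}}=0$ if $\boldsymbol{m}\notin\prod_t\{1,\dots,d_t\}$. Convolutional layers: $\mathcal{L}^{\boldsymbol{d},2\boldsymbol{k}+1}_{c,c'}$ is the set of maps $f=(f^1,\dots,f^{c'}):\mathbb{R}^{c\times\boldsymbol{d}}\to\mathbb{R}^{c'\times\boldsymbol{d}}$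 of the form $f^i(x)=\sum_{j=1}^{c}w_{i,j}\circledast x^j+\delta_i\boldsymbol{1}_{\boldsymbol{d}}$ with $w_{i,j}\in\mathbb{R}^{2\boldsymbol{k}+1}$, $\delta_i\in\mathbb{R}$. Deep narrow CNNs: $\sigma$ is applied componentwise. $\Delta^{\sigma,\boldsymbol{d},2\boldsymbol{k}+1}_{c,c',l}$ is the set of all functions $C_N\circ\sigma\circ C_{N-1}\circ\cdots\circ\sigma\circ C_1:\mathbb{R}^{c\times\boldsymbol{d}}\to\mathbb{R}^{c'\times\boldsymbol{d}}$, where $N\in\mathbb{N}$ is arbitrary, $b_0=c$, $b_N=c'$, $b_1,\dots,b_{N-1}\in\{1,\dots,l\}$ are arbitrary channel sizes, and $C_i\in\mathcal{L}^{\boldsymbol{d},2\boldsymbol{k}+1}_{b_{i-1},b_i}$. For a compact $K\subset\mathbb{R}^{c\times\boldsymbol{d}}$ its elements are restricted to $K$, and the overline denotes closure in $C(K,\mathbb{R}^{c'\times\boldsymbol{d}})$ with respect to the uniform norm $\|f\|_{\infty,K}=\sup_{x\in K}\|f(x)\|_\infty$. *)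

theory Defs
  imports "HOL-Analysis.Analysis"
begin

text \<open>
  The number of spatial dimensions is the cardinality of a finite type of axes. Multi-indices are
  integer vectors over it, so that differences of indices may leave the index box. A tensor is a
  function on all multi-indices that vanishes off the box, so that channel numbers and side lengths can
  vary without changing the type. Likewise a \<open>c\<close>-channel tensor vanishes off the
  channels \<open>1, \<dots>, c\<close>.
\<close>

type_synonym 'n index = "int ^ 'n"
type_synonym 'n tensor = "'n index \<Rightarrow> real"
type_synonym 'n mtensor = "nat \<Rightarrow> 'n tensor"

definition box_of :: "nat ^ 'n::finite \<Rightarrow> 'n index set" where
  "box_of d = {i. \<forall>t. 1 \<le> i $ t \<and> i $ t \<le> int (d $ t)}"

definition kernel_box :: "nat ^ 'n::finite \<Rightarrow> 'n index set" where
  "kernel_box k = {j. \<forall>t. \<bar>j $ t\<bar> \<le> int (k $ t)}"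

definition mtensors :: "nat \<Rightarrow> nat ^ 'n::finite \<Rightarrow> 'n mtensor set" where
  "mtensors c d = {x. \<forall>j i. \<not> (j \<in> {1..c} \<and> i \<in> box_of d) \<longrightarrow> x j i = 0}"

definition ones :: "nat ^ 'n::finite \<Rightarrow> 'n tensor" where
  "ones d i = (if i \<in> box_of d then 1 else 0)"

text \<open>A kernel is a function on all multi-indices of which only the values on \<open>kernel_box k\<close> are used.\<close>

definition conv :: "nat ^ 'n::finite \<Rightarrow> nat ^ 'n \<Rightarrow> ('n index \<Rightarrow> real) \<Rightarrow> 'n tensor \<Rightarrow> 'n tensor" where
  "conv d k w x i =
     (if i \<in> box_of d
      then \<Sum>j\<in>kernel_box k. w j * (if i - j \<in> box_of d then x (i - j) else 0)
      else 0)"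

definition conv_layer ::
  "nat ^ 'n::finite \<Rightarrow> nat ^ 'n \<Rightarrow> nat \<Rightarrow> nat \<Rightarrow> (nat \<Rightarrow> nat \<Rightarrow> 'n index \<Rightarrow> real) \<Rightarrow> (nat \<Rightarrow> real)
     \<Rightarrow> 'n mtensor \<Rightarrow> 'n mtensor" where
  "conv_layer d k c c' w \<delta> x i m =
     (if i \<in> {1..c'} then (\<Sum>j=1..c. conv d k (w i j) (x j) m) + \<delta> i * ones d m else 0)"

definition conv_layers :: "nat ^ 'n::finite \<Rightarrow> nat ^ 'n \<Rightarrow> nat \<Rightarrow> nat \<Rightarrow> ('n mtensor \<Rightarrow> 'n mtensor) set" where
  "conv_layers d k c c' = {conv_layer d k c c' w \<delta> | w \<delta>. True}"

text \<open>As \<open>\<sigma> 0\<close> need not be 0, the activation must be applied to actual entries only.\<close>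

definition act :: "(real \<Rightarrow> real) \<Rightarrow> nat ^ 'n::finite \<Rightarrow> nat \<Rightarrow> 'n mtensor \<Rightarrow> 'n mtensor" where
  "act \<sigma> d c x j i = (if j \<in> {1..c} \<and> i \<in> box_of d then \<sigma> (x j i) else 0)"

text \<open>\<open>compose_layers \<sigma> d b C n\<close> is \<open>C\<^sub>n\<^sub>+\<^sub>1 \<circ> \<sigma> \<circ> C\<^sub>n \<circ> \<dots> \<circ> \<sigma> \<circ> C\<^sub>1\<close>, with \<open>b i\<close> output channels of \<open>C\<^sub>i\<close>.\<close>

primrec compose_layers ::
  "(real \<Rightarrow> real) \<Rightarrow> nat ^ 'n::finite \<Rightarrow> (nat \<Rightarrow> nat) \<Rightarrow> (nat \<Rightarrow> 'n mtensor \<Rightarrow> 'n mtensor)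
     \<Rightarrow> nat \<Rightarrow> 'n mtensor \<Rightarrow> 'n mtensor" where
  "compose_layers \<sigma> d b C 0 = C 1"
| "compose_layers \<sigma> d b C (Suc n) =
     C (n + 2) \<circ> act \<sigma> d (b (n + 1)) \<circ> compose_layers \<sigma> d b C n"

definition deep_cnns ::
  "(real \<Rightarrow> real) \<Rightarrow> nat ^ 'n::finite \<Rightarrow> nat ^ 'n \<Rightarrow> nat \<Rightarrow> nat \<Rightarrow> nat \<Rightarrow> ('n mtensor \<Rightarrow> 'n mtensor) set" where
  "deep_cnns \<sigma> d k c c' l =
     {compose_layers \<sigma> d b C (N - 1) | N b C.
        1 \<le> N \<and> b 0 = c \<and> b N = c' \<and> (\<forall>i\<in>{1..<N}. b i \<in> {1..l}) \<and>
        (\<forall>i\<in>{1..N}. C i \<in> conv_layers d k (b (i - 1)) (b i))}"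

text \<open>Inserting 0 only matters when there are no entries, where it gives the norm 0.\<close>

definition max_norm :: "nat \<Rightarrow> nat ^ 'n::finite \<Rightarrow> 'n mtensor \<Rightarrow> real" where
  "max_norm c d x = Max (insert 0 ((\<lambda>(j, i). \<bar>x j i\<bar>) ` ({1..c} \<times> box_of d)))"

definition mtensor_metric :: "nat \<Rightarrow> nat ^ 'n::finite \<Rightarrow> 'n mtensor metric" where
  "mtensor_metric c d = metric (mtensors c d, \<lambda>x y. max_norm c d (\<lambda>j i. x j i - y j i))"

text \<open>Functions on \<open>X\<close> are represented as extensional functions.\<close>

definition cont_funs :: "'a::topological_space set \<Rightarrow> 'b::topological_space set \<Rightarrow> ('a \<Rightarrow> 'b) set" where
  "cont_funs X Y = {f \<in> X \<rightarrow>\<^sub>E Y. continuous_on X f}"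

text \<open>
  Closure with respect to the supremum over \<open>K\<close> of \<open>max_norm\<close>: this supremum distance is the one of
  \<^const>\<open>cfunspace\<close>.
\<close>

definition uniform_closure ::
  "'n mtensor set \<Rightarrow> nat \<Rightarrow> nat ^ 'n::finite \<Rightarrow> ('n mtensor \<Rightarrow> 'n mtensor) set \<Rightarrow> ('n mtensor \<Rightarrow> 'n mtensor) set" where
  "uniform_closure K c d F =
     mtopology_of (cfunspace (top_of_set K) (mtensor_metric c d)) closure_of ((\<lambda>f. restrict f K) ` F)"

text \<open>
  The metric is well-formed, and its topology is the subspace topology of the product topology,
  which \<^const>\<open>compact\<close> and \<^const>\<open>continuous_on\<close> refer to.
\<close>

lemma finite_box_of [simp]: "finite (box_of d)"
proof -
  have "(\<lambda>i. vec_nth i) ` box_of d \<subseteq> PiE UNIV (\<lambda>t. {1..int (d $ t)})"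
    by (auto simp: box_of_def)
  moreover have "finite (PiE UNIV (\<lambda>t. {1..int (d $ t)}))"
    by (intro finite_PiE) auto
  ultimately have "finite ((\<lambda>i. vec_nth i) ` box_of d)"
    by (rule finite_subset)
  then show ?thesis
    by (rule finite_imageD) (simp add: inj_on_def vec_nth_inject)
qed

lemma max_norm_less_iff:
  "max_norm c d x < r \<longleftrightarrow> 0 < r \<and> (\<forall>j\<in>{1..c}. \<forall>i\<in>box_of d. \<bar>x j i\<bar> < r)"
  unfolding max_norm_def by (subst Max_less_iff) auto

lemma max_norm_le_iff:
  "max_norm c d x \<le> r \<longleftrightarrow> 0 \<le> r \<and> (\<forall>j\<in>{1..c}. \<forall>i\<in>box_of d. \<bar>x j i\<bar> \<le> r)"
  unfolding max_norm_def by (subst Max_le_iff) auto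

lemma Metric_space_mtensors:
  "Metric_space (mtensors c d) (\<lambda>x y. max_norm c d (\<lambda>j i. x j i - y j i))"
proof
  show "0 \<le> max_norm c d (\<lambda>j i. x j i - y j i)" for x y
    using max_norm_le_iff[of c d "\<lambda>j i. x j i - y j i"] by blast
  show "max_norm c d (\<lambda>j i. x j i - y j i) = max_norm c d (\<lambda>j i. y j i - x j i)" for x y
    by (simp add: max_norm_def abs_minus_commute)
  show "max_norm c d (\<lambda>j i. x j i - y j i) = 0 \<longleftrightarrow> x = y"
    if "x \<in> mtensors c d" "y \<in> mtensors c d" for x y
  proof
    assume "max_norm c d (\<lambda>j i. x j i - y j i) = 0"
    then have "\<forall>j\<in>{1..c}. \<forall>i\<in>box_of d. \<bar>x j i - y j i\<bar> \<le> 0"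
      using max_norm_le_iff[of c d "\<lambda>j i. x j i - y j i" 0] by simp
    then have "x j i = y j i" for j i
      using that by (cases "j \<in> {1..c} \<and> i \<in> box_of d") (auto simp: mtensors_def)
    then show "x = y" by (simp add: fun_eq_iff)
  next
    assume "x = y"
    then show "max_norm c d (\<lambda>j i. x j i - y j i) = 0"
      by (intro antisym) (auto simp: max_norm_le_iff, simp add: max_norm_def)
  qed
  show "max_norm c d (\<lambda>j i. x j i - z j i)
      \<le> max_norm c d (\<lambda>j i. x j i - y j i) + max_norm c d (\<lambda>j i. y j i - z j i)" for x y z
  proof -
    have a: "0 \<le> max_norm c d u \<and> (\<forall>j\<in>{1..c}. \<forall>i\<in>box_of d. \<bar>u j i\<bar> \<le> max_norm c d u)" for u
      using max_norm_le_iff[of c d u] by blast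
    show ?thesis
      unfolding max_norm_le_iff
      using a[of "\<lambda>j i. x j i - y j i"] a[of "\<lambda>j i. y j i - z j i"]
      by (smt (verit) add_nonneg_nonneg)
  qed
qed

lemma mspace_mtensor_metric [simp]: "mspace (mtensor_metric c d) = mtensors c d"
  by (simp add: mtensor_metric_def Metric_space.mspace_metric[OF Metric_space_mtensors])

lemma mdist_mtensor_metric [simp]:
  "mdist (mtensor_metric c d) x y = max_norm c d (\<lambda>j i. x j i - y j i)"
  by (simp add: mtensor_metric_def Metric_space.mdist_metric[OF Metric_space_mtensors])

lemma continuous_map_coordinatewise:
  assumes "\<And>k. continuous_map X euclidean (\<lambda>x. f x k)"
  shows "continuous_map X euclidean f"
  unfolding euclidean_product_topology[symmetric] continuous_map_componentwise_UNIV
  by (intro allI assms)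

lemma mtopology_of_mtensor_metric: "mtopology_of (mtensor_metric c d) = top_of_set (mtensors c d)"
proof -
  interpret M: Metric_space "mtensors c d" "\<lambda>x y. max_norm c d (\<lambda>j i. x j i - y j i)"
    by (rule Metric_space_mtensors)
  have top: "mtopology_of (mtensor_metric c d) = M.mtopology"
    by (simp add: mtensor_metric_def)
  have coord: "continuous_map M.mtopology euclidean (\<lambda>x. x j i)" for j i
  proof (cases "j \<in> {1..c} \<and> i \<in> box_of d")
    case True
    have "\<exists>\<delta>>0. \<forall>y. y \<in> mtensors c d \<and> max_norm c d (\<lambda>j i. x j i - y j i) < \<delta> \<longrightarrow> dist (x j i) (y j i) < e"
      if "e > 0" for x :: "'a mtensor" and e
      using that True by (intro exI[of _ e]) (auto simp: max_norm_less_iff dist_real_def)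
    then have "continuous_map M.mtopology Met_TC.mtopology (\<lambda>x. x j i)"
      by (subst M.metric_continuous_map[OF Met_TC.Metric_space_axioms]) auto
    then show ?thesis by simp
  next
    case False
    have zero: "x j i = 0" if "x \<in> mtensors c d" for x
      using that False unfolding mtensors_def by blast
    show ?thesis
      by (rule continuous_map_eq[where f = "\<lambda>x. 0"]) (simp_all add: zero)
  qed
  have "continuous_map M.mtopology euclidean (\<lambda>x. x j)" for j
    by (rule continuous_map_coordinatewise) (rule coord)
  then have ident: "continuous_map M.mtopology euclidean (\<lambda>x. x)"
    by (rule continuous_map_coordinatewise)
  show ?thesis
    unfolding top topology_eq
  proof (intro allI iffI)
    fix S assume S: "openin (top_of_set (mtensors c d)) S"
    then obtain T where T: "open T" "S = mtensors c d \<inter> T"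
      by (auto simp: openin_open)
    have "openin M.mtopology {x \<in> topspace M.mtopology. x \<in> T}"
      using ident T(1) by (intro openin_continuous_map_preimage[OF ident]) simp
    moreover have "{x \<in> topspace M.mtopology. x \<in> T} = S" using T by auto
    ultimately show "openin M.mtopology S" by simp
  next
    fix S assume S: "openin M.mtopology S"
    show "openin (top_of_set (mtensors c d)) S"
    proof (subst openin_subopen, intro ballI)
      fix x assume "x \<in> S"
      with S obtain r where r: "0 < r" "M.mball x r \<subseteq> S" and x: "x \<in> mtensors c d"
        unfolding M.openin_mtopology by blast
      define T where "T = (\<Inter>p\<in>{1..c} \<times> box_of d. {y. \<bar>x (fst p) (snd p) - y (fst p) (snd p)\<bar> < r})"
      have co: "continuous_on UNIV (\<lambda>y :: 'a mtensor. y j i)" for j i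
        by (rule continuous_on_product_then_coordinatewise[OF continuous_on_product_coordinates])
      have "open T" unfolding T_def
        by (intro open_INT ballI open_Collect_less continuous_on_rabs continuous_on_diff continuous_on_const co) simp
      moreover have "mtensors c d \<inter> T \<subseteq> S"
        using r x by (auto simp: T_def M.in_mball max_norm_less_iff subset_iff)
      ultimately show "\<exists>T. openin (top_of_set (mtensors c d)) T \<and> x \<in> T \<and> T \<subseteq> S"
        using x r by (intro exI[of _ "mtensors c d \<inter> T"]) (auto simp: T_def openin_open)
    qed
  qed
qed

end

theory Submission
  imports Defs
begin

text \<open>
  Near \<open>\<alpha>\<close> the activation is almost linear, so a network can carry channels along unchanged while
  applying \<open>\<sigma>\<close> or a convolution to a single one. Since zero padding loses what is shifted out of the box,
  compositions of shifts give every matrix unit on a channel, so a linear form \<open>l\<close> of the input can be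
  added to any entry. Besides the input and output channels there are a register \<open>p\<close> and a scratch
  channel. Small steps \<open>p := p + c * \<sigma> (w * (p + s * l) + \<theta>)\<close> compose to approximations of the flow of
  any vector field in the closed span of the functions \<open>\<sigma> (w * (p + s * l) + \<theta>)\<close>. As \<open>\<sigma>\<close> is not affine, this
  span contains the squares of \<open>p + s * l\<close> and hence \<open>p * l\<close>, whose flow takes \<open>p = 1\<close> to \<open>exp l\<close> at time 1.
  Adding multiples of such exponentials to the output entries suffices by the
  Stone-Weierstrass theorem.
\<close>

subsection \<open>Squares in the closed span of a non-affine function\<close>

text \<open>The target function need not commute with translations, whereas convolutions do away
  from the border; isolating single entries exploits the zeros beyond it. The price is that two
  convolutions in general do not compose to a convolution, so an activation must stand between them
  and be made harmless on the channels carried along. The width leaves no room to store the linear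
  form \<open>l\<close>: it is added to the register, \<open>\<sigma>\<close> is applied to a copy,
  and the same multiple of \<open>l\<close> is subtracted again, recomputed from the input, which
  keeps its own channels. Nor is there room for intermediate products. Exponentials of linear forms
  are closed under multiplication as functions, so Stone-Weierstrass asks the network only for sums,
  and the register is reused for each summand. In the flow of \<open>p' = p * l\<close> the
  parameter \<open>l\<close> is constant in time; \<open>p * l\<close> comes from the squares of
  \<open>p + l\<close> and \<open>p - l\<close>, which is why gates carry the factor
  \<open>s\<close>.\<close>

lemma additive_continuous_imp_linear:
  fixes f :: "real \<Rightarrow> real"
  assumes add: "\<And>x y. f (x + y) = f x + f y" and cont: "continuous_on UNIV f"
  shows "f x = f 1 * x"
proof -
  have zero: "f 0 = 0" using add[of 0 0] by simp
  have nat: "f (real n * x) = real n * f x" for n x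
    by (induction n) (simp_all add: zero add algebra_simps)
  have neg: "f (- x) = - f x" for x using add[of x "-x"] zero by simp
  have int: "f (of_int m * x) = of_int m * f x" for m x
  proof (cases m rule: int_cases2)
    case (nonneg n)
    then show ?thesis using nat[of n x] by simp
  next
    case (nonpos n)
    then show ?thesis using nat[of n x] neg[of "real n * x"] by simp
  qed
  have rat: "f q = f 1 * q" if "q \<in> \<rat>" for q
  proof -
    obtain a b where q: "q = of_int a / of_int b" "b \<noteq> 0"
      by (rule Rats_cases'[OF \<open>q \<in> \<rat>\<close>]) auto
    have "of_int b * f q = f (of_int a * 1)" using q int[of b q] by simp
    also have "\<dots> = of_int a * f 1" by (rule int)
    finally have "of_int b * f q = of_int b * (f 1 * q)" using q by simp
    then show ?thesis using q(2) by simp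
  qed
  have "closed {x. f x = f 1 * x}"
    by (intro closed_Collect_eq continuous_intros cont)
  moreover have "\<rat> \<subseteq> {x. f x = f 1 * x}" using rat by (intro subsetI CollectI)
  ultimately have "closure \<rat> \<subseteq> {x. f x = f 1 * x}" by (simp add: closure_minimal)
  then show ?thesis by (subst (asm) Rats_closure_real) blast
qed

text \<open>Nonnegative increments suffice, because the four points \<open>0\<close>,
  \<open>u\<close>, \<open>v\<close>, \<open>u + v\<close> form such a configuration when based at
  the right one of them. What remains is Cauchy's functional equation for \<open>f\<close> minus
  \<open>f 0\<close>.\<close>

lemma affine_if_differences_vanish:
  fixes f :: "real \<Rightarrow> real"
  assumes cont: "continuous_on UNIV f"
    and diff: "\<And>x a b. 0 \<le> a \<Longrightarrow> 0 \<le> b \<Longrightarrow> f (x + a + b) - f (x + a) - f (x + b) + f x = 0"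
  shows "\<exists>a b. \<forall>x. f x = a * x + b"
proof -
  have eq: "f (u + v) + f 0 = f u + f v" for u v
  proof -
    consider "u \<ge> 0" "v \<ge> 0" | "u \<le> 0" "v \<le> 0" | "u \<ge> 0" "v \<le> 0" | "u \<le> 0" "v \<ge> 0" by linarith
    then show ?thesis
      using diff[of u v 0] diff[of "-u" "-v" "u + v"] diff[of u "-v" v] diff[of "-u" v u]
      by cases (simp_all add: algebra_simps)
  qed
  define g where "g x = f x - f 0" for x
  have "g x = g 1 * x" for x
  proof (rule additive_continuous_imp_linear)
    show "g (x + y) = g x + g y" for x y using eq[of x y] by (simp add: g_def)
    show "continuous_on UNIV g" unfolding g_def by (intro continuous_intros cont)
  qed
  then have "\<forall>x. f x = g 1 * x + f 0" unfolding g_def by (metis add.commute diff_add_cancel)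
  then show ?thesis by blast
qed

lemma continuous_antiderivative:
  fixes f :: "real \<Rightarrow> real"
  assumes "continuous_on UNIV f"
  obtains F where "\<And>x. (F has_field_derivative f x) (at x)"
proof -
  have "\<exists>F. \<forall>x::real. -\<infinity> < ereal x \<longrightarrow> ereal x < \<infinity> \<longrightarrow> (F has_vector_derivative f x) (at x)"
    using assms by (intro einterval_antiderivative) (auto simp: continuous_on_eq_continuous_at)
  then show ?thesis using that by (auto simp: has_real_derivative_iff_has_vector_derivative)
qed

text \<open>The error has derivative \<open>G' (x0 + u) - G' (x0 - u) - 2 * k * u\<close>, and
  differentiability of \<open>G'\<close> at the single point \<open>x0\<close> bounds this by
  \<open>e * \<bar>u\<bar>\<close>. The mean value inequality supplies the second factor
  \<open>\<bar>u\<bar>\<close>.\<close>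

lemma second_difference_estimate:
  fixes G G' :: "real \<Rightarrow> real"
  assumes G: "\<And>x. (G has_field_derivative G' x) (at x)"
    and G': "(G' has_field_derivative k) (at x0)" and "0 < e"
  obtains r where "0 < r" "\<And>u. \<bar>u\<bar> < r \<Longrightarrow> \<bar>G (x0 + u) + G (x0 - u) - 2 * G x0 - k * u\<^sup>2\<bar> \<le> e * u\<^sup>2"
proof -
  from G' have "\<exists>r>0. \<forall>y. norm (y - x0) < r \<longrightarrow> norm (G' y - G' x0 - k * (y - x0)) \<le> e / 2 * norm (y - x0)"
    unfolding has_field_derivative_def has_derivative_at_alt using \<open>0 < e\<close> by (meson half_gt_zero)
  then obtain r where r: "0 < r"
    "\<And>y. \<bar>y - x0\<bar> < r \<Longrightarrow> \<bar>G' y - G' x0 - k * (y - x0)\<bar> \<le> e / 2 * \<bar>y - x0\<bar>"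
    by auto
  define p where "p u = G (x0 + u) + G (x0 - u) - 2 * G x0 - k * u\<^sup>2" for u
  have dp: "(p has_field_derivative G' (x0 + u) - G' (x0 - u) - 2 * k * u) (at u)" for u
  proof -
    have "((\<lambda>u. G (x0 + u)) has_field_derivative G' (x0 + u) * 1) (at u)"
      by (rule DERIV_chain2[OF G]) (auto intro!: derivative_eq_intros)
    moreover have "((\<lambda>u. G (x0 - u)) has_field_derivative G' (x0 - u) * (-1)) (at u)"
      by (rule DERIV_chain2[OF G]) (auto intro!: derivative_eq_intros)
    ultimately show ?thesis unfolding p_def by (auto intro!: derivative_eq_intros)
  qed
  have "\<bar>p u\<bar> \<le> e * u\<^sup>2" if u: "\<bar>u\<bar> < r" for u
  proof -
    have "norm (p u - p 0) \<le> (e * \<bar>u\<bar>) * norm (u - 0)"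
    proof (rule field_differentiable_bound[where S = "cball 0 \<bar>u\<bar>" and f' = "\<lambda>u. G' (x0 + u) - G' (x0 - u) - 2 * k * u"])
      show "(p has_field_derivative G' (x0 + z) - G' (x0 - z) - 2 * k * z) (at z within cball 0 \<bar>u\<bar>)" for z
        by (rule has_field_derivative_at_within[OF dp])
      fix z :: real assume "z \<in> cball 0 \<bar>u\<bar>"
      then have z: "\<bar>z\<bar> \<le> \<bar>u\<bar>" by simp
      have "\<bar>G' (x0 + z) - G' x0 - k * z\<bar> \<le> e / 2 * \<bar>z\<bar>" using r(2)[of "x0 + z"] z u by simp
      moreover have "\<bar>G' (x0 - z) - G' x0 + k * z\<bar> \<le> e / 2 * \<bar>z\<bar>" using r(2)[of "x0 - z"] z u by simp
      ultimately have "\<bar>G' (x0 + z) - G' (x0 - z) - 2 * k * z\<bar> \<le> e * \<bar>z\<bar>"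
        unfolding abs_le_iff by (simp add: field_simps)
      also have "\<dots> \<le> e * \<bar>u\<bar>" using z \<open>0 < e\<close> by simp
      finally show "norm (G' (x0 + z) - G' (x0 - z) - 2 * k * z) \<le> e * \<bar>u\<bar>" by simp
    qed auto
    then show ?thesis by (simp add: p_def power2_eq_square)
  qed
  then show ?thesis using that[OF r(1)] by (simp add: p_def)
qed

text \<open>Left Riemann sums converge to the integral from \<open>x\<close> to \<open>x + a\<close>
  uniformly in bounded \<open>x\<close>. They are combinations of translates of \<open>f\<close>, so
  integration does not lead out of a closed span that is invariant under translations.\<close>

lemma riemann_sum_estimate:
  fixes f F :: "real \<Rightarrow> real"
  assumes F: "\<And>x. (F has_field_derivative f x) (at x)"
    and cont: "continuous_on UNIV f" and "0 \<le> a" "0 < e"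
  shows "\<exists>n::nat>0. \<forall>x. \<bar>x\<bar> \<le> R \<longrightarrow> \<bar>(\<Sum>i<n. a / n * f (x + i * (a / n))) - (F (x + a) - F x)\<bar> \<le> e"
proof -
  have uc: "uniformly_continuous_on {-(\<bar>R\<bar> + a)..\<bar>R\<bar> + a} f"
    using cont by (intro compact_uniformly_continuous continuous_on_subset[OF cont]) auto
  obtain r where r: "0 < r"
    "\<And>u v. \<bar>u\<bar> \<le> \<bar>R\<bar> + a \<Longrightarrow> \<bar>v\<bar> \<le> \<bar>R\<bar> + a \<Longrightarrow> \<bar>u - v\<bar> < r \<Longrightarrow> \<bar>f u - f v\<bar> < e / (a + 1)"
  proof -
    \<comment> \<open>\<open>a + 1\<close> instead of \<open>a\<close> in the denominator admits
      \<open>a = 0\<close>.\<close>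
    have "0 < e / (a + 1)" using \<open>0 \<le> a\<close> \<open>0 < e\<close> by simp
    then obtain r where "0 < r"
      "\<And>u v. u \<in> {-(\<bar>R\<bar> + a)..\<bar>R\<bar> + a} \<Longrightarrow> v \<in> {-(\<bar>R\<bar> + a)..\<bar>R\<bar> + a} \<Longrightarrow> dist v u < r \<Longrightarrow> dist (f v) (f u) < e / (a + 1)"
      using uc unfolding uniformly_continuous_on_def by blast
    then show ?thesis by (intro that[of r]) (auto simp: dist_real_def abs_le_iff)
  qed
  obtain n :: nat where n: "a / r < n" "0 < n"
    using reals_Archimedean2[of "max 0 (a / r)"] by auto
  define h where "h = a / n"
  have h: "0 \<le> h" "h < r" using n r \<open>0 \<le> a\<close> by (auto simp: h_def field_simps)
  have nh: "n * h = a" using n by (simp add: h_def)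
  have "\<bar>(\<Sum>i<n. h * f (x + i * h)) - (F (x + a) - F x)\<bar> \<le> e" if x: "\<bar>x\<bar> \<le> R" for x
  proof -
    have step: "\<bar>h * f (x + i * h) - (F (x + Suc i * h) - F (x + i * h))\<bar> \<le> h * (e / (a + 1))" if "i < n" for i
    proof (cases "h = 0")
      case False
      then have "0 < h" using h by simp
      then obtain z where z: "x + i * h < z" "z < x + Suc i * h"
        "F (x + Suc i * h) - F (x + i * h) = (x + Suc i * h - (x + i * h)) * f z"
        using MVT2[of "x + i * h" "x + Suc i * h" F f] F by (auto simp: algebra_simps)
      have le: "Suc i * h \<le> a" using \<open>i < n\<close> \<open>0 < h\<close> nh
        by (metis Suc_leI h(1) mult_right_mono of_nat_le_iff)
      have "0 \<le> i * h" using h by simp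
      have "i * h \<le> Suc i * h" using h by (simp add: algebra_simps)
      then have "\<bar>x + i * h\<bar> \<le> \<bar>R\<bar> + a" "\<bar>z\<bar> \<le> \<bar>R\<bar> + a" "\<bar>x + i * h - z\<bar> < r"
        using x z(1,2) le h \<open>0 \<le> i * h\<close> unfolding of_nat_Suc distrib_right by linarith+
      then have "\<bar>f (x + i * h) - f z\<bar> \<le> e / (a + 1)" using r(2) less_imp_le by blast
      then have "h * \<bar>f (x + i * h) - f z\<bar> \<le> h * (e / (a + 1))" using h by (intro mult_left_mono) auto
      moreover have "h * f (x + i * h) - (F (x + Suc i * h) - F (x + i * h)) = h * (f (x + i * h) - f z)"
        by (subst z(3)) (simp add: algebra_simps)
      ultimately show ?thesis using h by (simp add: abs_mult)
    qed simp
    have "F (x + a) - F x = (\<Sum>i<n. F (x + Suc i * h) - F (x + i * h))"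
      by (subst sum_lessThan_telescope) (simp add: nh)
    then have "\<bar>(\<Sum>i<n. h * f (x + i * h)) - (F (x + a) - F x)\<bar>
        = \<bar>\<Sum>i<n. h * f (x + i * h) - (F (x + Suc i * h) - F (x + i * h))\<bar>"
      by (simp add: sum_subtractf)
    also have "\<dots> \<le> (\<Sum>i<n. h * (e / (a + 1)))"
      by (rule order_trans[OF sum_abs sum_mono]) (use step in auto)
    also have "\<dots> = a * (e / (a + 1))" using nh by simp
    also have "\<dots> \<le> e" using \<open>0 \<le> a\<close> \<open>0 < e\<close> by (simp add: field_simps)
    finally show ?thesis .
  qed
  then show ?thesis using n(2) unfolding h_def by blast
qed

text \<open>
  The Steklov average \<open>G x = \<integral>\<^sub>0\<^sup>a \<integral>\<^sub>0\<^sup>b \<sigma> (x + s + t)\<close> of \<open>\<sigma>\<close> is \<open>C\<^sup>2\<close>, and its second derivative is a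
  mixed second difference of \<open>\<sigma>\<close>, which does not vanish identically unless \<open>\<sigma>\<close> is affine.
\<close>

lemma square_in_closed_span:
  fixes \<sigma> :: "real \<Rightarrow> real" and V :: "(real \<Rightarrow> real) set"
  assumes cont: "continuous_on UNIV \<sigma>" and nonaff: "\<not> (\<exists>a b. \<forall>x. \<sigma> x = a * x + b)"
    and in_V: "\<sigma> \<in> V"
    and add: "\<And>f g. f \<in> V \<Longrightarrow> g \<in> V \<Longrightarrow> (\<lambda>x. f x + g x) \<in> V"
    and scale: "\<And>c f. f \<in> V \<Longrightarrow> (\<lambda>x. c * f x) \<in> V"
    and affine: "\<And>f w \<theta>. f \<in> V \<Longrightarrow> (\<lambda>x. f (w * x + \<theta>)) \<in> V"
    and lim: "\<And>f. continuous_on UNIV f \<Longrightarrow>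
      (\<And>R e. 0 < R \<Longrightarrow> 0 < e \<Longrightarrow> \<exists>g\<in>V. \<forall>x. \<bar>x\<bar> \<le> R \<longrightarrow> \<bar>g x - f x\<bar> \<le> e) \<Longrightarrow> f \<in> V"
  shows "(\<lambda>x. x\<^sup>2) \<in> V"
proof -
  have zero: "(\<lambda>x. 0) \<in> V" using scale[OF in_V, of 0] by simp
  have sum: "(\<lambda>x. \<Sum>i<n. g i x) \<in> V" if "\<And>i. g i \<in> V" for g :: "nat \<Rightarrow> real \<Rightarrow> real" and n
    by (induction n) (use zero add that in auto)
  have steklov: "(\<lambda>x. F (x + a) - F x) \<in> V"
    if g: "g \<in> V" "continuous_on UNIV g" and F: "\<And>x. (F has_field_derivative g x) (at x)" and a: "0 \<le> a"
    for g F :: "real \<Rightarrow> real" and a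
  proof (rule lim)
    have "continuous_on UNIV F"
      using F by (meson DERIV_continuous continuous_at_imp_continuous_on)
    then have "continuous_on UNIV (\<lambda>x. F (x + a))"
      by (rule continuous_on_compose2) (auto intro!: continuous_intros)
    then show "continuous_on UNIV (\<lambda>x. F (x + a) - F x)"
      by (intro continuous_intros \<open>continuous_on UNIV F\<close>)
    fix R e :: real assume "0 < e"
    obtain n :: nat where "\<forall>x. \<bar>x\<bar> \<le> R \<longrightarrow> \<bar>(\<Sum>i<n. a / n * g (x + i * (a / n))) - (F (x + a) - F x)\<bar> \<le> e"
      using riemann_sum_estimate[OF F g(2) a \<open>0 < e\<close>] by blast
    moreover have "(\<lambda>x. \<Sum>i<n. a / n * g (x + i * (a / n))) \<in> V"
    proof (intro sum scale)
      show "(\<lambda>x. g (x + i * (a / n))) \<in> V" for i :: nat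
        using affine[OF g(1), of 1] by simp
    qed
    ultimately show "\<exists>h\<in>V. \<forall>x. \<bar>x\<bar> \<le> R \<longrightarrow> \<bar>h x - (F (x + a) - F x)\<bar> \<le> e" by (rule bexI)
  qed
  obtain x0 a b where ab: "0 \<le> a" "0 \<le> b" "\<sigma> (x0 + a + b) - \<sigma> (x0 + a) - \<sigma> (x0 + b) + \<sigma> x0 \<noteq> 0"
    using affine_if_differences_vanish[OF cont] nonaff by blast
  obtain F1 where F1: "\<And>x. (F1 has_field_derivative \<sigma> x) (at x)"
    using continuous_antiderivative[OF cont] by blast
  define g where "g x = F1 (x + a) - F1 x" for x
  have dg: "(g has_field_derivative \<sigma> (x + a) - \<sigma> x) (at x)" for x
    unfolding g_def using F1 by (intro DERIV_diff) (simp_all flip: DERIV_shift)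
  have gV: "g \<in> V" unfolding g_def by (rule steklov[OF in_V cont F1 ab(1)])
  have gc: "continuous_on UNIV g"
    using dg by (meson DERIV_continuous continuous_at_imp_continuous_on)
  obtain F2 where F2: "\<And>x. (F2 has_field_derivative g x) (at x)"
    using continuous_antiderivative[OF gc] by blast
  define G where "G x = F2 (x + b) - F2 x" for x
  have GV: "G \<in> V" unfolding G_def by (rule steklov[OF gV gc F2 ab(2)])
  define G' where "G' x = g (x + b) - g x" for x
  define k where "k = \<sigma> (x0 + a + b) - \<sigma> (x0 + a) - \<sigma> (x0 + b) + \<sigma> x0"
  have G: "(G has_field_derivative G' x) (at x)" for x
    unfolding G_def G'_def using F2 by (intro DERIV_diff) (simp_all flip: DERIV_shift)
  have "(G' has_field_derivative (\<sigma> (x0 + b + a) - \<sigma> (x0 + b)) - (\<sigma> (x0 + a) - \<sigma> x0)) (at x0)"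
    unfolding G'_def using dg by (intro DERIV_diff) (simp_all flip: DERIV_shift)
  then have G': "(G' has_field_derivative k) (at x0)" by (simp add: k_def algebra_simps)
  have "k \<noteq> 0" using ab by (simp add: k_def)
  show ?thesis
  proof (rule lim)
    show "continuous_on UNIV (\<lambda>x::real. x\<^sup>2)" by (intro continuous_intros)
    fix R e :: real assume "0 < R" "0 < e"
    \<comment> \<open>Dividing the estimate for \<open>G\<close> by
      \<open>\<bar>k\<bar> * h\<^sup>2\<close> will leave the error
      \<open>e' * x\<^sup>2 / \<bar>k\<bar>\<close>, which is at most \<open>e\<close> for
      \<open>\<bar>x\<bar> \<le> R\<close>.\<close>
    define e' where "e' = e * \<bar>k\<bar> / R\<^sup>2"
    have "0 < e'" using \<open>0 < R\<close> \<open>0 < e\<close> \<open>k \<noteq> 0\<close> by (simp add: e'_def)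
    obtain r where r: "0 < r"
      "\<And>u. \<bar>u\<bar> < r \<Longrightarrow> \<bar>G (x0 + u) + G (x0 - u) - 2 * G x0 - k * u\<^sup>2\<bar> \<le> e' * u\<^sup>2"
      using second_difference_estimate[OF G G' \<open>0 < e'\<close>] by blast
    define h where "h = r / (2 * R)"
    have h: "0 < h" "h * R < r" using r \<open>0 < R\<close> by (auto simp: h_def)
    \<comment> \<open>The rescaled symmetric second difference of \<open>G\<close> at
      \<open>x0\<close>, which tends to the square as \<open>h\<close> tends to 0. The coefficient 0
      in \<open>G (0 * x + x0)\<close> presents a constant as an affine substitution.\<close>
    define q where "q x = 1 / (k * h\<^sup>2) * (G (h * x + x0) + (G ((-h) * x + x0) + (-2) * G (0 * x + x0)))" for x
    have "q \<in> V" unfolding q_def by (intro scale add affine GV)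
    moreover have "\<bar>q x - x\<^sup>2\<bar> \<le> e" if x: "\<bar>x\<bar> \<le> R" for x
    proof -
      have "\<bar>h * x\<bar> \<le> h * R" using x h by (simp add: abs_mult)
      then have "\<bar>h * x\<bar> < r" using h by linarith
      from r(2)[OF this] have b: "\<bar>G (x0 + h * x) + G (x0 - h * x) - 2 * G x0 - k * (h * x)\<^sup>2\<bar> \<le> e' * (h * x)\<^sup>2" .
      have nz: "k * h\<^sup>2 \<noteq> 0" using h \<open>k \<noteq> 0\<close> by simp
      have "q x - x\<^sup>2 = (G (x0 + h * x) + G (x0 - h * x) - 2 * G x0 - k * (h * x)\<^sup>2) / (k * h\<^sup>2)"
        using h \<open>k \<noteq> 0\<close> by (simp add: q_def field_simps power_mult_distrib)
      then have "\<bar>q x - x\<^sup>2\<bar> \<le> e' * (h * x)\<^sup>2 / (\<bar>k\<bar> * h\<^sup>2)"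
        using b h by (simp add: abs_mult divide_right_mono)
      also have "\<dots> = e * (x\<^sup>2 / R\<^sup>2)" using h \<open>k \<noteq> 0\<close> by (simp add: e'_def power_mult_distrib)
      also have "\<dots> \<le> e * 1"
        using x \<open>0 < e\<close> \<open>0 < R\<close> by (intro mult_left_mono) (auto simp: abs_le_square_iff[symmetric])
      finally show ?thesis by simp
    qed
    ultimately show "\<exists>g\<in>V. \<forall>x. \<bar>x\<bar> \<le> R \<longrightarrow> \<bar>g x - x\<^sup>2\<bar> \<le> e" by blast
  qed
qed

subsection \<open>The exponential function by composition of gates\<close>

fun gate :: "(real \<Rightarrow> real) \<Rightarrow> real \<times> real \<times> real \<times> real \<Rightarrow> real \<Rightarrow> real \<Rightarrow> real" where
  "gate \<sigma> (c, w, \<theta>, s) l p = p + c * \<sigma> (w * (p + s * l) + \<theta>)"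

definition gates :: "(real \<Rightarrow> real) \<Rightarrow> (real \<times> real \<times> real \<times> real) list \<Rightarrow> real \<Rightarrow> real \<Rightarrow> real" where
  "gates \<sigma> as l p = fold (\<lambda>a. gate \<sigma> a l) as p"

lemma gates_simps [simp]:
  "gates \<sigma> [] l p = p"
  "gates \<sigma> (a # as) l p = gates \<sigma> as l (gate \<sigma> a l p)"
  "gates \<sigma> (as @ bs) l p = gates \<sigma> bs l (gates \<sigma> as l p)"
  by (simp_all add: gates_def)

text \<open>
  The vector fields \<open>g\<close>, with parameter \<open>l\<close>, for which Euler steps of the equation \<open>p' = g p l\<close> are
  approximated by compositions of gates.
\<close>

definition gate_field :: "(real \<Rightarrow> real) \<Rightarrow> (real \<Rightarrow> real \<Rightarrow> real) \<Rightarrow> bool" where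
  "gate_field \<sigma> g \<longleftrightarrow> continuous_on UNIV (\<lambda>(p, l). g p l) \<and>
     (\<forall>R>0. \<forall>e>0. \<exists>t0>0. \<forall>t. 0 < t \<and> t < t0 \<longrightarrow>
        (\<exists>as. \<forall>p l. \<bar>p\<bar> \<le> R \<longrightarrow> \<bar>l\<bar> \<le> R \<longrightarrow> \<bar>gates \<sigma> as l p - (p + t * g p l)\<bar> \<le> e * t))"

lemma gate_fieldD:
  assumes "gate_field \<sigma> g" "0 < R" "0 < e"
  obtains t0 where "0 < t0" "\<And>t. 0 < t \<Longrightarrow> t < t0 \<Longrightarrow>
     \<exists>as. \<forall>p l. \<bar>p\<bar> \<le> R \<longrightarrow> \<bar>l\<bar> \<le> R \<longrightarrow> \<bar>gates \<sigma> as l p - (p + t * g p l)\<bar> \<le> e * t"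
  using assms unfolding gate_field_def by metis

lemma continuous_on_affine_comp:
  fixes f :: "real \<Rightarrow> real"
  assumes "continuous_on UNIV f"
  shows "continuous_on UNIV (\<lambda>(p, l). c * f (w * (p + s * l) + \<theta>))"
  unfolding split_def
  by (intro continuous_intros continuous_on_compose2[OF assms]) auto

text \<open>The time step is absorbed in the coefficient, so a single gate is an exact Euler step
  for every \<open>t\<close>.\<close>

lemma gate_field_basic:
  assumes "continuous_on UNIV \<sigma>"
  shows "gate_field \<sigma> (\<lambda>p l. c * \<sigma> (w * (p + s * l) + \<theta>))"
  unfolding gate_field_def
proof (intro conjI allI impI continuous_on_affine_comp assms)
  fix R e :: real assume "0 < R" "0 < e"
  have "\<exists>as. \<forall>p l. \<bar>p\<bar> \<le> R \<longrightarrow> \<bar>l\<bar> \<le> R \<longrightarrow>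
      \<bar>gates \<sigma> as l p - (p + t * (c * \<sigma> (w * (p + s * l) + \<theta>)))\<bar> \<le> e * t" if "0 < t" for t
    using that \<open>0 < e\<close> by (intro exI[of _ "[(t * c, w, \<theta>, s)]"]) simp
  then show "\<exists>t0>0. \<forall>t. 0 < t \<and> t < t0 \<longrightarrow> (\<exists>as. \<forall>p l. \<bar>p\<bar> \<le> R \<longrightarrow> \<bar>l\<bar> \<le> R \<longrightarrow>
      \<bar>gates \<sigma> as l p - (p + t * (c * \<sigma> (w * (p + s * l) + \<theta>)))\<bar> \<le> e * t)"
    by (intro exI[of _ 1]) simp
qed

lemma gate_field_limit:
  assumes cont: "continuous_on UNIV (\<lambda>(p, l). g p l)"
    and lim: "\<And>R e. 0 < R \<Longrightarrow> 0 < e \<Longrightarrow>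
      \<exists>h. gate_field \<sigma> h \<and> (\<forall>p l. \<bar>p\<bar> \<le> R \<longrightarrow> \<bar>l\<bar> \<le> R \<longrightarrow> \<bar>h p l - g p l\<bar> \<le> e)"
  shows "gate_field \<sigma> g"
  unfolding gate_field_def
proof (intro conjI allI impI cont)
  fix R e :: real assume "0 < R" "0 < e"
  obtain h where h: "gate_field \<sigma> h" "\<And>p l. \<bar>p\<bar> \<le> R \<Longrightarrow> \<bar>l\<bar> \<le> R \<Longrightarrow> \<bar>h p l - g p l\<bar> \<le> e / 2"
    using lim[of R "e / 2"] \<open>0 < R\<close> \<open>0 < e\<close> by auto
  obtain t0 where t0: "0 < t0" "\<And>t. 0 < t \<Longrightarrow> t < t0 \<Longrightarrow>
     \<exists>as. \<forall>p l. \<bar>p\<bar> \<le> R \<longrightarrow> \<bar>l\<bar> \<le> R \<longrightarrow> \<bar>gates \<sigma> as l p - (p + t * h p l)\<bar> \<le> e / 2 * t"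
    using gate_fieldD[OF h(1) \<open>0 < R\<close>, of "e / 2"] \<open>0 < e\<close> by auto
  show "\<exists>t0>0. \<forall>t. 0 < t \<and> t < t0 \<longrightarrow> (\<exists>as. \<forall>p l. \<bar>p\<bar> \<le> R \<longrightarrow> \<bar>l\<bar> \<le> R \<longrightarrow>
      \<bar>gates \<sigma> as l p - (p + t * g p l)\<bar> \<le> e * t)"
  proof (intro exI[of _ t0] conjI t0(1) allI impI)
    fix t assume "0 < t \<and> t < t0"
    then obtain as where as: "\<And>p l. \<bar>p\<bar> \<le> R \<Longrightarrow> \<bar>l\<bar> \<le> R \<Longrightarrow> \<bar>gates \<sigma> as l p - (p + t * h p l)\<bar> \<le> e / 2 * t"
      using t0(2) by blast
    have "\<bar>gates \<sigma> as l p - (p + t * g p l)\<bar> \<le> e * t" if "\<bar>p\<bar> \<le> R" "\<bar>l\<bar> \<le> R" for p l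
    proof -
      have "\<bar>t * h p l - t * g p l\<bar> \<le> e * t / 2"
        using mult_left_mono[OF h(2)[OF that], of t] \<open>0 < t \<and> t < t0\<close>
        by (simp flip: right_diff_distrib add: abs_mult mult.commute)
      moreover have "\<bar>gates \<sigma> as l p - (p + t * h p l)\<bar> \<le> e * t / 2" using as[OF that] by simp
      ultimately show ?thesis by linarith
    qed
    then show "\<exists>as. \<forall>p l. \<bar>p\<bar> \<le> R \<longrightarrow> \<bar>l\<bar> \<le> R \<longrightarrow> \<bar>gates \<sigma> as l p - (p + t * g p l)\<bar> \<le> e * t"
      by blast
  qed
qed

text \<open>Operator splitting: the gates for \<open>g\<close> move \<open>p\<close> to some
  \<open>q\<close> at a distance of order \<open>t\<close>, and the gates for \<open>h\<close> start
  from there. By uniform continuity of \<open>h\<close>, evaluating it at \<open>q\<close> instead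
  of \<open>p\<close> costs only a third of the error \<open>e * t\<close>.\<close>

lemma gate_field_add:
  assumes g: "gate_field \<sigma> g" and h: "gate_field \<sigma> h"
  shows "gate_field \<sigma> (\<lambda>p l. g p l + h p l)"
  unfolding gate_field_def
proof (intro conjI allI impI)
  have cg: "continuous_on UNIV (\<lambda>(p, l). g p l)" and ch: "continuous_on UNIV (\<lambda>(p, l). h p l)"
    using g h by (auto simp: gate_field_def)
  then show "continuous_on UNIV (\<lambda>(p, l). g p l + h p l)"
    unfolding split_def by (intro continuous_on_add)
  fix R e :: real assume "0 < R" "0 < e"
  let ?B = "{-(R + 1)..R + 1} \<times> {-(R + 1)..R + 1}"
  have B: "compact ?B" by (intro compact_Times) auto
  have "bounded ((\<lambda>(p, l). g p l) ` ?B)"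
    by (intro compact_imp_bounded compact_continuous_image continuous_on_subset[OF cg] B) auto
  then obtain M where M: "0 < M" "\<And>x. x \<in> ?B \<Longrightarrow> norm (case x of (p, l) \<Rightarrow> g p l) \<le> M"
    unfolding bounded_pos by auto
  have "uniformly_continuous_on ?B (\<lambda>(p, l). h p l)"
    by (intro compact_uniformly_continuous continuous_on_subset[OF ch] B) auto
  then obtain r where r: "0 < r" "\<And>x y. x \<in> ?B \<Longrightarrow> y \<in> ?B \<Longrightarrow> dist y x < r \<Longrightarrow>
      dist (case y of (p, l) \<Rightarrow> h p l) (case x of (p, l) \<Rightarrow> h p l) < e / 3"
    using \<open>0 < e\<close> unfolding uniformly_continuous_on_def
    by (metis (no_types, lifting) zero_less_divide_iff zero_less_numeral)
  obtain t1 where t1: "0 < t1" "\<And>t. 0 < t \<Longrightarrow> t < t1 \<Longrightarrow>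
     \<exists>as. \<forall>p l. \<bar>p\<bar> \<le> R \<longrightarrow> \<bar>l\<bar> \<le> R \<longrightarrow> \<bar>gates \<sigma> as l p - (p + t * g p l)\<bar> \<le> e / 3 * t"
    using gate_fieldD[OF g \<open>0 < R\<close>, of "e / 3"] \<open>0 < e\<close> by auto
  obtain t2 where t2: "0 < t2" "\<And>t. 0 < t \<Longrightarrow> t < t2 \<Longrightarrow>
     \<exists>as. \<forall>p l. \<bar>p\<bar> \<le> R + 1 \<longrightarrow> \<bar>l\<bar> \<le> R + 1 \<longrightarrow> \<bar>gates \<sigma> as l p - (p + t * h p l)\<bar> \<le> e / 3 * t"
    using gate_fieldD[OF h, of "R + 1" "e / 3"] \<open>0 < R\<close> \<open>0 < e\<close> by auto
  \<comment> \<open>Since \<open>\<bar>q - p\<bar> < t * (M + e)\<close>, the last two bounds keep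
    \<open>q\<close> in the enlarged square \<open>?B\<close> and within \<open>r\<close> of
    \<open>p\<close>.\<close>
  define t0 where "t0 = Min {t1, t2, 1 / (M + e), r / (M + e)}"
  have Me: "0 < M + e" using M \<open>0 < e\<close> by simp
  have t0: "0 < t0" using t1 t2 r Me by (simp add: t0_def)
  show "\<exists>t0>0. \<forall>t. 0 < t \<and> t < t0 \<longrightarrow> (\<exists>as. \<forall>p l. \<bar>p\<bar> \<le> R \<longrightarrow> \<bar>l\<bar> \<le> R \<longrightarrow>
      \<bar>gates \<sigma> as l p - (p + t * (g p l + h p l))\<bar> \<le> e * t)"
  proof (intro exI[of _ t0] conjI t0 allI impI)
    fix t assume t: "0 < t \<and> t < t0"
    then have tt: "t < t1" "t < t2" "t * (M + e) < 1" "t * (M + e) < r"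
      using Me by (auto simp: t0_def pos_less_divide_eq)
    obtain as where as: "\<And>p l. \<bar>p\<bar> \<le> R \<Longrightarrow> \<bar>l\<bar> \<le> R \<Longrightarrow> \<bar>gates \<sigma> as l p - (p + t * g p l)\<bar> \<le> e / 3 * t"
      using t1(2)[of t] t tt by blast
    obtain bs where bs: "\<And>p l. \<bar>p\<bar> \<le> R + 1 \<Longrightarrow> \<bar>l\<bar> \<le> R + 1 \<Longrightarrow> \<bar>gates \<sigma> bs l p - (p + t * h p l)\<bar> \<le> e / 3 * t"
      using t2(2)[of t] t tt by blast
    have "\<bar>gates \<sigma> (as @ bs) l p - (p + t * (g p l + h p l))\<bar> \<le> e * t" if pl: "\<bar>p\<bar> \<le> R" "\<bar>l\<bar> \<le> R" for p l
    proof -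
      define q where "q = gates \<sigma> as l p"
      have a: "\<bar>q - (p + t * g p l)\<bar> \<le> t * e / 3" using as[OF pl] by (simp add: q_def mult.commute)
      have "(p, l) \<in> ?B" using pl by auto
      then have "\<bar>g p l\<bar> \<le> M" using M(2) by fastforce
      then have "\<bar>t * g p l\<bar> \<le> t * M" using t by (simp add: abs_mult)
      moreover have "0 < t * e" using t \<open>0 < e\<close> by simp
      ultimately have d: "\<bar>q - p\<bar> < t * (M + e)" using a unfolding distrib_left by linarith
      then have q: "\<bar>q\<bar> \<le> R + 1" and "\<bar>q - p\<bar> < r" using tt pl by linarith+
      moreover have "(p, l) \<in> ?B" "(q, l) \<in> ?B" using pl q by (auto simp: abs_le_iff)
      ultimately have "dist (h q l) (h p l) < e / 3"
        using r(2)[of "(p, l)" "(q, l)"] by (simp add: dist_Pair_Pair dist_real_def)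
      then have "\<bar>h q l - h p l\<bar> \<le> e / 3" by (simp add: dist_real_def)
      from mult_left_mono[OF this, of t] have "\<bar>t * h q l - t * h p l\<bar> \<le> t * e / 3"
        using t by (simp flip: right_diff_distrib add: abs_mult)
      moreover have "\<bar>gates \<sigma> bs l q - (q + t * h q l)\<bar> \<le> t * e / 3"
        using bs[OF q, of l] pl by (simp add: mult.commute)
      moreover have "e * t = t * e" by simp
      ultimately show ?thesis using a unfolding gates_simps q_def[symmetric] distrib_left by linarith
    qed
    then show "\<exists>as. \<forall>p l. \<bar>p\<bar> \<le> R \<longrightarrow> \<bar>l\<bar> \<le> R \<longrightarrow> \<bar>gates \<sigma> as l p - (p + t * (g p l + h p l))\<bar> \<le> e * t"
      by blast
  qed
qed

text \<open>The continuous functions whose compositions with all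
  \<open>w * (p + s * l) + \<theta>\<close> give gate fields form a closed space invariant under
  affine substitutions, so it contains the square. Polarization with \<open>s = 1\<close> and
  \<open>s = - 1\<close> then gives the product.\<close>

lemma gate_field_mult:
  assumes cont: "continuous_on UNIV \<sigma>" and nonaff: "\<not> (\<exists>a b. \<forall>x. \<sigma> x = a * x + b)"
  shows "gate_field \<sigma> (\<lambda>p l. p * l)"
proof -
  define V where "V = {f. continuous_on UNIV f \<and> (\<forall>c w s \<theta>. gate_field \<sigma> (\<lambda>p l. c * f (w * (p + s * l) + \<theta>)))}"
  have "(\<lambda>x. x\<^sup>2) \<in> V"
  proof (rule square_in_closed_span[OF cont nonaff])
    show "\<sigma> \<in> V" using cont gate_field_basic[OF cont] unfolding V_def by blast
  next
    fix f g assume "f \<in> V" "g \<in> V"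
    then have f: "continuous_on UNIV f" "continuous_on UNIV g"
      "\<And>c w s \<theta>. gate_field \<sigma> (\<lambda>p l. c * f (w * (p + s * l) + \<theta>))"
      "\<And>c w s \<theta>. gate_field \<sigma> (\<lambda>p l. c * g (w * (p + s * l) + \<theta>))"
      unfolding V_def by blast+
    show "(\<lambda>x. f x + g x) \<in> V"
      unfolding V_def
    proof (intro CollectI conjI allI continuous_on_add f)
      show "gate_field \<sigma> (\<lambda>p l. c * (f (w * (p + s * l) + \<theta>) + g (w * (p + s * l) + \<theta>)))" for c w s \<theta>
        unfolding distrib_left[of c] by (intro gate_field_add f)
    qed
  next
    fix c f assume "f \<in> V"
    then have f: "continuous_on UNIV f" "\<And>c w s \<theta>. gate_field \<sigma> (\<lambda>p l. c * f (w * (p + s * l) + \<theta>))"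
      unfolding V_def by blast+
    show "(\<lambda>x. c * f x) \<in> V"
      unfolding V_def
    proof (intro CollectI conjI allI continuous_on_mult_left f)
      show "gate_field \<sigma> (\<lambda>p l. c' * (c * f (w * (p + s * l) + \<theta>)))" for c' w s \<theta>
        unfolding mult.assoc[symmetric, of c' c] by (rule f)
    qed
  next
    fix f w \<theta> assume f: "f \<in> V"
    then have "continuous_on UNIV f" unfolding V_def by blast
    then have "continuous_on UNIV (\<lambda>x. f (w * x + \<theta>))"
      by (rule continuous_on_compose2) (auto intro!: continuous_intros)
    moreover have "gate_field \<sigma> (\<lambda>p l. c * f (w * (w' * (p + s * l) + \<theta>') + \<theta>))" for c w' s \<theta>'
    proof -
      have "gate_field \<sigma> (\<lambda>p l. c * f ((w * w') * (p + s * l) + (w * \<theta>' + \<theta>)))"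
        using f unfolding V_def by blast
      moreover have "(w * w') * (p + s * l) + (w * \<theta>' + \<theta>) = w * (w' * (p + s * l) + \<theta>') + \<theta>" for p l
        by (simp add: algebra_simps)
      ultimately show ?thesis by simp
    qed
    ultimately show "(\<lambda>x. f (w * x + \<theta>)) \<in> V" unfolding V_def by blast
  next
    fix f :: "real \<Rightarrow> real"
    assume f: "continuous_on UNIV f"
      and lim: "\<And>R e. 0 < R \<Longrightarrow> 0 < e \<Longrightarrow> \<exists>g\<in>V. \<forall>x. \<bar>x\<bar> \<le> R \<longrightarrow> \<bar>g x - f x\<bar> \<le> e"
    have "gate_field \<sigma> (\<lambda>p l. c * f (w * (p + s * l) + \<theta>))" for c w s \<theta>
    proof (rule gate_field_limit[OF continuous_on_affine_comp[OF f]])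
      fix R e :: real assume "0 < R" "0 < e"
      define R' where "R' = \<bar>w\<bar> * (R + \<bar>s\<bar> * R) + \<bar>\<theta>\<bar> + 1"
      have "0 < R'" using \<open>0 < R\<close> by (auto simp: R'_def intro!: add_nonneg_pos add_nonneg_nonneg mult_nonneg_nonneg)
      moreover have "0 < e / (\<bar>c\<bar> + 1)" using \<open>0 < e\<close> by simp
      ultimately obtain g where g: "g \<in> V" "\<And>x. \<bar>x\<bar> \<le> R' \<Longrightarrow> \<bar>g x - f x\<bar> \<le> e / (\<bar>c\<bar> + 1)"
        using lim by blast
      have "\<bar>c * g (w * (p + s * l) + \<theta>) - c * f (w * (p + s * l) + \<theta>)\<bar> \<le> e"
        if "\<bar>p\<bar> \<le> R" "\<bar>l\<bar> \<le> R" for p l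
      proof -
        have "\<bar>p + s * l\<bar> \<le> R + \<bar>s\<bar> * R"
          using that by (intro order_trans[OF abs_triangle_ineq] add_mono) (auto simp: abs_mult mult_left_mono)
        then have "\<bar>w * (p + s * l)\<bar> \<le> \<bar>w\<bar> * (R + \<bar>s\<bar> * R)" by (simp add: abs_mult mult_left_mono)
        then have "\<bar>w * (p + s * l) + \<theta>\<bar> \<le> R'" unfolding R'_def by linarith
        from mult_left_mono[OF g(2)[OF this], of "\<bar>c\<bar>"]
        have "\<bar>c * g (w * (p + s * l) + \<theta>) - c * f (w * (p + s * l) + \<theta>)\<bar> \<le> \<bar>c\<bar> * (e / (\<bar>c\<bar> + 1))"
          by (simp flip: right_diff_distrib add: abs_mult)
        also have "\<dots> \<le> e" using \<open>0 < e\<close> by (simp add: field_simps)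
        finally show ?thesis .
      qed
      moreover have "gate_field \<sigma> (\<lambda>p l. c * g (w * (p + s * l) + \<theta>))" using g(1) unfolding V_def by blast
      ultimately show "\<exists>h. gate_field \<sigma> h \<and> (\<forall>p l. \<bar>p\<bar> \<le> R \<longrightarrow> \<bar>l\<bar> \<le> R \<longrightarrow> \<bar>h p l - c * f (w * (p + s * l) + \<theta>)\<bar> \<le> e)"
        by blast
    qed
    then show "f \<in> V" unfolding V_def by (intro CollectI conjI allI f)
  qed
  then have sq: "gate_field \<sigma> (\<lambda>p l. c * (w * (p + s * l) + \<theta>)\<^sup>2)" for c w s \<theta>
    by (simp only: V_def mem_Collect_eq)
  have "(\<lambda>p l :: real. (1 / 4) * (1 * (p + 1 * l) + 0)\<^sup>2 + (- 1 / 4) * (1 * (p + (- 1) * l) + 0)\<^sup>2) = (\<lambda>p l. p * l)"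
    by (intro ext) (simp add: power2_eq_square algebra_simps)
  moreover have "gate_field \<sigma> (\<lambda>p l. (1 / 4) * (1 * (p + 1 * l) + 0)\<^sup>2 + (- 1 / 4) * (1 * (p + (- 1) * l) + 0)\<^sup>2)"
    by (intro gate_field_add sq)
  ultimately show ?thesis by (simp only:)
qed

text \<open>For negative \<open>x\<close>, \<open>exp x \<le> 1 / (1 - x)\<close>, and
  \<open>(1 + x + x\<^sup>2) * (1 - x) = 1 - x ^ 3\<close> is at least 1.\<close>

lemma exp_minus_first_order:
  fixes x :: real
  assumes "\<bar>x\<bar> \<le> 1"
  shows "\<bar>exp x - (1 + x)\<bar> \<le> x\<^sup>2"
proof -
  have "exp x \<le> 1 + x + x\<^sup>2"
  proof (cases "0 \<le> x")
    case True
    then show ?thesis using assms by (intro exp_bound) auto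
  next
    case False
    have "0 < 1 - x" using False by simp
    have "exp x = inverse (exp (- x))" by (simp add: exp_minus)
    also have "\<dots> \<le> inverse (1 - x)"
      using exp_ge_add_one_self[of "- x"] \<open>0 < 1 - x\<close> by (intro le_imp_inverse_le) auto
    also have "\<dots> \<le> 1 + x + x\<^sup>2"
    proof -
      have "x * x * x \<le> 0" using False by (simp add: mult_le_0_iff)
      then have "1 \<le> (1 + x + x\<^sup>2) * (1 - x)" by (simp add: algebra_simps power2_eq_square)
      then show ?thesis using \<open>0 < 1 - x\<close> by (simp add: inverse_eq_divide pos_divide_le_eq)
    qed
    finally show ?thesis .
  qed
  then show ?thesis using exp_ge_add_one_self[of x] by simp
qed

text \<open>Euler's method for \<open>p' = p * l\<close> with \<open>n\<close> equal steps on the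
  unit time interval. The gates for one step serve all \<open>l\<close> at once, so repeating one
  list \<open>n\<close> times is the whole method.\<close>

lemma gates_approximate_exp:
  assumes cont: "continuous_on UNIV \<sigma>" and nonaff: "\<not> (\<exists>a b. \<forall>x. \<sigma> x = a * x + b)"
    and "0 < R" "0 < e"
  shows "\<exists>as. \<forall>l. \<bar>l\<bar> \<le> R \<longrightarrow> \<bar>gates \<sigma> as l 1 - exp l\<bar> \<le> e"
proof -
  \<comment> \<open>The error accumulated up to time 1 is bounded by \<open>2 * e' * exp R\<close>.
    It has to be at most \<open>e\<close>, and at most 1 so that the iterates stay in the range
    where the gates are accurate.\<close>
  define e' where "e' = min e 1 * exp (- R) / 2"
  have e': "0 < e'" "2 * e' * exp R \<le> e" "2 * e' * exp R \<le> 1"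
    using \<open>0 < e\<close> by (auto simp: e'_def exp_minus field_simps)
  have R2: "0 < exp R + 1" "R \<le> exp R + 1" using exp_ge_add_one_self[of R] by (simp add: add_pos_pos, linarith)
  obtain t0 where t0: "0 < t0" "\<And>t. 0 < t \<Longrightarrow> t < t0 \<Longrightarrow>
     \<exists>as. \<forall>p l. \<bar>p\<bar> \<le> exp R + 1 \<longrightarrow> \<bar>l\<bar> \<le> exp R + 1 \<longrightarrow> \<bar>gates \<sigma> as l p - (p + t * (p * l))\<bar> \<le> e' * t"
    using gate_fieldD[OF gate_field_mult[OF cont nonaff] R2(1) e'(1)] by blast
  obtain n :: nat where n: "Max {1, 1 / t0, exp R * R\<^sup>2 / e', R} < n" using reals_Archimedean2 by blast
  define t where "t = 1 / real n"
  have n': "1 < n" "1 / t0 < n" "exp R * R\<^sup>2 / e' < n" "R < n" using n by auto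
  have "0 < n" using n' by simp
  have t: "0 < t" "t < t0" "t * exp R * R\<^sup>2 \<le> e'" "t * R \<le> 1"
    using n' t0(1) e'(1) by (auto simp: t_def field_simps)
  have nt: "n * t = 1" using \<open>0 < n\<close> by (simp add: t_def)
  obtain as where as: "\<And>p l. \<bar>p\<bar> \<le> exp R + 1 \<Longrightarrow> \<bar>l\<bar> \<le> exp R + 1 \<Longrightarrow> \<bar>gates \<sigma> as l p - (p + t * (p * l))\<bar> \<le> e' * t"
    using t0(2)[OF t(1,2)] by blast
  \<comment> \<open>Discrete Gronwall inequality: a step multiplies the error by at most
    \<open>\<bar>1 + t * l\<bar> \<le> exp (t * R)\<close> and adds \<open>e' * t\<close> for the
    gates and \<open>e' * t\<close> for the deviation of the Euler step from the
    exponential.\<close>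
  have "\<bar>gates \<sigma> (concat (replicate k as)) l 1 - exp (k * t * l)\<bar> \<le> 2 * e' * t * k * exp (t * R * k)"
    if l: "\<bar>l\<bar> \<le> R" and "k \<le> n" for l k
    using \<open>k \<le> n\<close>
  proof (induction k)
    case 0
    then show ?case by simp
  next
    case (Suc k)
    define p where "p = gates \<sigma> (concat (replicate k as)) l 1"
    define q where "q = exp (k * t * l)"
    define E where "E = 2 * e' * t * k * exp (t * R * k)"
    have pq: "\<bar>p - q\<bar> \<le> E" using Suc by (simp add: p_def q_def E_def)
    have kt: "k * t \<le> 1" "0 \<le> k * t"
      using Suc.prems nt t(1) by (metis mult_right_mono less_imp_le of_nat_le_iff Suc_leD) (use t in simp)
    have "k * t * l \<le> k * t * R" using kt l by (intro mult_left_mono) auto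
    also have "\<dots> \<le> 1 * R" using kt \<open>0 < R\<close> by (intro mult_right_mono) auto
    finally have "k * t * l \<le> R" by simp
    then have q: "0 < q" "q \<le> exp R" by (auto simp: q_def)
    have "E = 2 * e' * ((k * t) * exp ((k * t) * R))" by (simp add: E_def mult_ac)
    also have "(k * t) * exp ((k * t) * R) \<le> 1 * exp (1 * R)"
      using kt \<open>0 < R\<close> by (intro mult_mono) auto
    finally have "E \<le> 1" using e' by simp
    then have p: "\<bar>p\<bar> \<le> exp R + 1" using pq q by linarith
    have tl: "\<bar>t * l\<bar> \<le> t * R" using l t by (simp add: abs_mult)
    have ge: "\<bar>gates \<sigma> as l p - (p + t * (p * l))\<bar> \<le> e' * t" using as[OF p] l R2 by simp
    have ex: "\<bar>q * (1 + t * l) - q * exp (t * l)\<bar> \<le> e' * t"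
    proof -
      have "\<bar>t * l\<bar> \<le> 1" using tl t(4) by linarith
      from exp_minus_first_order[OF this] have "\<bar>(1 + t * l) - exp (t * l)\<bar> \<le> (t * R)\<^sup>2"
        using power_mono[OF tl, of 2] by (simp add: abs_minus_commute)
      then have "q * \<bar>(1 + t * l) - exp (t * l)\<bar> \<le> exp R * (t * R)\<^sup>2"
        using q by (intro mult_mono) auto
      also have "\<dots> = t * (t * exp R * R\<^sup>2)" by (simp add: power2_eq_square)
      also have "\<dots> \<le> t * e'" using t by (intro mult_left_mono) auto
      finally show ?thesis using q by (simp flip: right_diff_distrib add: abs_mult mult.commute)
    qed
    have eE: "\<bar>(p - q) * (1 + t * l)\<bar> \<le> E * exp (t * R)"
    proof -
      have "\<bar>1 + t * l\<bar> \<le> exp (t * R)" using tl exp_ge_add_one_self[of "t * R"] by linarith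
      then show ?thesis using pq unfolding abs_mult by (intro mult_mono) auto
    qed
    have "exp (Suc k * t * l) = q * exp (t * l)" by (simp add: q_def algebra_simps flip: exp_add)
    moreover have "gates \<sigma> (concat (replicate (Suc k) as)) l 1 = gates \<sigma> as l p"
    proof -
      have "concat (replicate (Suc k) as) = concat (replicate k as) @ as"
        by (induction k) auto
      then show ?thesis by (simp add: p_def)
    qed
    moreover have "p + t * (p * l) - q * exp (t * l) = (p - q) * (1 + t * l) + (q * (1 + t * l) - q * exp (t * l))"
      by (simp add: algebra_simps)
    ultimately have "\<bar>gates \<sigma> (concat (replicate (Suc k) as)) l 1 - exp (Suc k * t * l)\<bar> \<le> E * exp (t * R) + 2 * e' * t"
      using ge ex eE by linarith
    also have "\<dots> \<le> E * exp (t * R) + 2 * e' * t * exp (t * R * Suc k)"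
      using e' t \<open>0 < R\<close> by simp
    also have "\<dots> = 2 * e' * t * Suc k * exp (t * R * Suc k)"
      by (simp add: E_def algebra_simps flip: exp_add)
    finally show ?case .
  qed
  note main = this[of _ n]
  have "\<bar>gates \<sigma> (concat (replicate n as)) l 1 - exp l\<bar> \<le> e" if "\<bar>l\<bar> \<le> R" for l
  proof -
    have "2 * e' * t * n * exp (t * R * n) = 2 * e' * (n * t) * exp (R * (n * t))" by (simp add: mult_ac)
    also have "\<dots> = 2 * e' * exp R" unfolding nt by simp
    finally have "2 * e' * t * n * exp (t * R * n) \<le> e" using e'(2) by (rule ord_eq_le_trans)
    moreover have "\<bar>gates \<sigma> (concat (replicate n as)) l 1 - exp (n * t * l)\<bar> \<le> 2 * e' * t * n * exp (t * R * n)"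
      using main[OF that] by simp
    ultimately show ?thesis unfolding nt by simp
  qed
  then show ?thesis by blast
qed

subsection \<open>Convolutional layers\<close>

lemma zero_in_kernel_box [simp]: "0 \<in> kernel_box k"
  by (simp add: kernel_box_def)

lemma finite_kernel_box [simp]: "finite (kernel_box k)"
proof -
  have "(\<lambda>i. vec_nth i) ` kernel_box k \<subseteq> PiE UNIV (\<lambda>t. {- int (k $ t)..int (k $ t)})"
    by (auto simp: kernel_box_def abs_le_iff minus_le_iff)
  moreover have "finite (PiE UNIV (\<lambda>t. {- int (k $ t)..int (k $ t)}))"
    by (intro finite_PiE) auto
  ultimately have "finite ((\<lambda>i. vec_nth i) ` kernel_box k)"
    by (rule finite_subset)
  then show ?thesis
    by (rule finite_imageD) (simp add: inj_on_def vec_nth_inject)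
qed

lemma conv_single:
  assumes "v \<in> kernel_box k"
  shows "conv d k (\<lambda>e. if e = v then a else 0) x i = (if i \<in> box_of d \<and> i - v \<in> box_of d then a * x (i - v) else 0)"
proof -
  have "(\<Sum>j\<in>kernel_box k. (if j = v then a else 0) * (if i - j \<in> box_of d then x (i - j) else 0))
      = (\<Sum>j\<in>kernel_box k. if j = v then a * (if i - v \<in> box_of d then x (i - v) else 0) else 0)"
    by (rule sum.cong) auto
  then show ?thesis using assms by (simp add: conv_def)
qed

lemma conv_pointwise:
  "conv d k (\<lambda>e. if e = 0 then a else 0) x i = (if i \<in> box_of d then a * x i else 0)"
  using conv_single[of 0 k d a x i] by simp

lemma conv_kernel_sum:
  "conv d k (\<lambda>e. \<Sum>j\<in>J. A j * w j e) x m = (\<Sum>j\<in>J. A j * conv d k (w j) x m)"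
  by (simp add: conv_def sum_distrib_right sum_distrib_left mult.assoc) (intro impI sum.swap)

lemma conv_zero_kernel [simp]: "conv d k (\<lambda>e. 0) x m = 0"
  by (simp add: conv_def)

lemma conv_diff:
  "conv d k w x m - conv d k w y m = conv d k w (\<lambda>i. x i - y i) m"
  by (auto simp: conv_def right_diff_distrib sum_subtractf[symmetric] intro!: sum.cong)

lemma conv_cong:
  "(\<And>i. i \<in> box_of d \<Longrightarrow> x i = y i) \<Longrightarrow> conv d k w x m = conv d k w y m"
  by (auto simp: conv_def intro!: sum.cong)

lemma conv_bound:
  assumes "\<And>i. i \<in> box_of d \<Longrightarrow> \<bar>x i\<bar> \<le> R" "0 \<le> R"
  shows "\<bar>conv d k w x m\<bar> \<le> (\<Sum>e\<in>kernel_box k. \<bar>w e\<bar>) * R"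
proof -
  have "\<bar>\<Sum>j\<in>kernel_box k. w j * (if m - j \<in> box_of d then x (m - j) else 0)\<bar> \<le> (\<Sum>e\<in>kernel_box k. \<bar>w e\<bar> * R)"
    using assms by (intro order_trans[OF sum_abs] sum_mono) (auto simp: abs_mult intro!: mult_left_mono)
  moreover have "0 \<le> (\<Sum>e\<in>kernel_box k. \<bar>w e\<bar>) * R" using assms by (simp add: sum_nonneg)
  ultimately show ?thesis by (simp add: conv_def sum_distrib_right)
qed

definition pointwise_layer ::
  "nat ^ 'n::finite \<Rightarrow> nat ^ 'n \<Rightarrow> nat \<Rightarrow> nat \<Rightarrow> (nat \<Rightarrow> nat \<Rightarrow> real) \<Rightarrow> (nat \<Rightarrow> real) \<Rightarrow> 'n mtensor \<Rightarrow> 'n mtensor" where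
  "pointwise_layer d k c c' A \<delta> = conv_layer d k c c' (\<lambda>i j e. if e = 0 then A i j else 0) \<delta>"

lemma pointwise_layer_in_conv_layers [simp]: "pointwise_layer d k c c' A \<delta> \<in> conv_layers d k c c'"
  unfolding pointwise_layer_def conv_layers_def by blast

lemma pointwise_layer_apply:
  "pointwise_layer d k c c' A \<delta> z i m =
     (if i \<in> {1..c'} \<and> m \<in> box_of d then (\<Sum>j=1..c. A i j * z j m) + \<delta> i else 0)"
  by (simp add: pointwise_layer_def conv_layer_def conv_pointwise ones_def)

text \<open>Kernels concentrated at 0 only form linear combinations of the kernels of
  \<open>C\<close>, so the kernel size does not grow, and biases stay constant over the box.\<close>

lemma pointwise_comp_conv_layer:
  assumes "C \<in> conv_layers d k c c'"
  shows "pointwise_layer d k c' c'' A \<delta> \<circ> C \<in> conv_layers d k c c''"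
proof -
  obtain w \<delta>' where C: "C = conv_layer d k c c' w \<delta>'" using assms by (auto simp: conv_layers_def)
  have "pointwise_layer d k c' c'' A \<delta> (C z) i m
      = conv_layer d k c c'' (\<lambda>i a e. \<Sum>j=1..c'. A i j * w j a e) (\<lambda>i. (\<Sum>j=1..c'. A i j * \<delta>' j) + \<delta> i) z i m" for z i m
  proof (cases "i \<in> {1..c''} \<and> m \<in> box_of d")
    case True
    have "(\<Sum>j=1..c'. A i j * C z j m) = (\<Sum>j=1..c'. (\<Sum>a=1..c. A i j * conv d k (w j a) (z a) m) + A i j * \<delta>' j)"
      using True by (intro sum.cong) (auto simp: C conv_layer_def ones_def distrib_left sum_distrib_left)
    also have "\<dots> = (\<Sum>a=1..c. \<Sum>j=1..c'. A i j * conv d k (w j a) (z a) m) + (\<Sum>j=1..c'. A i j * \<delta>' j)"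
      by (simp add: sum.distrib) (rule sum.swap)
    finally show ?thesis
      using True by (simp add: pointwise_layer_apply conv_layer_def ones_def conv_kernel_sum)
  next
    case False
    then show ?thesis
      by (auto simp: pointwise_layer_apply conv_layer_def ones_def conv_def)
  qed
  then have "pointwise_layer d k c' c'' A \<delta> \<circ> C
      = conv_layer d k c c'' (\<lambda>i a e. \<Sum>j=1..c'. A i j * w j a e) (\<lambda>i. (\<Sum>j=1..c'. A i j * \<delta>' j) + \<delta> i)"
    by (simp add: fun_eq_iff)
  then show ?thesis unfolding conv_layers_def by blast
qed

lemma conv_layer_in_mtensors: "C \<in> conv_layers d k c c' \<Longrightarrow> C z \<in> mtensors c' d"
  by (auto simp: conv_layers_def conv_layer_def mtensors_def conv_def ones_def)

lemma mtensorsD: "z \<in> mtensors c d \<Longrightarrow> \<not> (j \<in> {1..c} \<and> i \<in> box_of d) \<Longrightarrow> z j i = 0"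
  unfolding mtensors_def by blast

lemma act_in_mtensors: "act \<sigma> d c z \<in> mtensors c d"
  by (auto simp: act_def mtensors_def)

lemma compose_layers_cong:
  assumes "\<And>i. 1 \<le> i \<Longrightarrow> i \<le> n + 1 \<Longrightarrow> C i = C' i" "\<And>i. 1 \<le> i \<Longrightarrow> i \<le> n \<Longrightarrow> b i = b' i"
  shows "compose_layers \<sigma> d b C n = compose_layers \<sigma> d b' C' n"
  using assms by (induction n) auto

lemma deep_cnns_conv_layer:
  assumes "C \<in> conv_layers d k c c'"
  shows "C \<in> deep_cnns \<sigma> d k c c' l"
proof -
  have "C = compose_layers \<sigma> d (\<lambda>i. if i = 0 then c else c') (\<lambda>_. C) (1 - 1)" by simp
  then show ?thesis using assms unfolding deep_cnns_def
    by (intro CollectI exI[of _ 1] exI[of _ "\<lambda>i. if i = 0 then c else c'"] exI[of _ "\<lambda>_. C"] conjI) auto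
qed

text \<open>The map merges into the last layer, so no activation is spent. Only the hidden widths
  are bounded by \<open>l\<close>, hence \<open>c''\<close> is arbitrary.\<close>

lemma deep_cnns_pointwise:
  assumes "f \<in> deep_cnns \<sigma> d k c c' l"
  shows "pointwise_layer d k c' c'' A \<delta> \<circ> f \<in> deep_cnns \<sigma> d k c c'' l"
proof -
  obtain N b C where f: "f = compose_layers \<sigma> d b C (N - 1)" and N: "1 \<le> N" "b 0 = c" "b N = c'"
    "\<forall>i\<in>{1..<N}. b i \<in> {1..l}" "\<forall>i\<in>{1..N}. C i \<in> conv_layers d k (b (i - 1)) (b i)"
    using assms unfolding deep_cnns_def by blast
  define b' where "b' = b(N := c'')"
  define C' where "C' = C(N := pointwise_layer d k c' c'' A \<delta> \<circ> C N)"
  have "pointwise_layer d k c' c'' A \<delta> \<circ> f = compose_layers \<sigma> d b' C' (N - 1)"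
  proof (cases "N - 1")
    case 0
    then show ?thesis using N by (simp add: f C'_def fun_eq_iff)
  next
    case (Suc n)
    then have Nn: "N = n + 2" by simp
    have "compose_layers \<sigma> d b' C' n = compose_layers \<sigma> d b C n"
      by (rule compose_layers_cong) (auto simp: b'_def C'_def Nn)
    then show ?thesis by (simp add: f Nn comp_assoc) (simp add: b'_def C'_def Nn comp_assoc)
  qed
  moreover have "C' i \<in> conv_layers d k (b' (i - 1)) (b' i)" if "i \<in> {1..N}" for i
  proof (cases "i = N")
    case True
    then show ?thesis using N by (auto simp: C'_def b'_def intro!: pointwise_comp_conv_layer)
  next
    case False
    then have "C i \<in> conv_layers d k (b (i - 1)) (b i)" "i - 1 \<noteq> N" using N that by auto
    then show ?thesis using False by (simp add: C'_def b'_def)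
  qed
  moreover have "b' 0 = c" "b' N = c''" "\<forall>i\<in>{1..<N}. b' i \<in> {1..l}" using N by (auto simp: b'_def)
  ultimately show ?thesis using N(1) unfolding deep_cnns_def by blast
qed

text \<open>The former output becomes a hidden layer, which is why \<open>c'\<close> must obey the
  width bound.\<close>

lemma deep_cnns_act_layer:
  assumes "f \<in> deep_cnns \<sigma> d k c c' l" "c' \<in> {1..l}" "B \<in> conv_layers d k c' c''"
  shows "B \<circ> act \<sigma> d c' \<circ> f \<in> deep_cnns \<sigma> d k c c'' l"
proof -
  obtain N b C where f: "f = compose_layers \<sigma> d b C (N - 1)" and N: "1 \<le> N" "b 0 = c" "b N = c'"
    "\<forall>i\<in>{1..<N}. b i \<in> {1..l}" "\<forall>i\<in>{1..N}. C i \<in> conv_layers d k (b (i - 1)) (b i)"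
    using assms(1) unfolding deep_cnns_def by blast
  define b' where "b' = b(N + 1 := c'')"
  define C' where "C' = C(N + 1 := B)"
  obtain n where Nn: "N = Suc n" using N(1) by (cases N) auto
  have "compose_layers \<sigma> d b' C' n = compose_layers \<sigma> d b C n"
    by (rule compose_layers_cong) (auto simp: b'_def C'_def Nn)
  then have "B \<circ> act \<sigma> d c' \<circ> f = compose_layers \<sigma> d b' C' (N + 1 - 1)"
    using N(3) by (simp add: f Nn) (simp add: b'_def C'_def Nn)
  moreover have "C' i \<in> conv_layers d k (b' (i - 1)) (b' i)" if "i \<in> {1..N + 1}" for i
  proof (cases "i = N + 1")
    case True
    then show ?thesis using N assms(3) by (auto simp: C'_def b'_def)
  next
    case False
    then have "C i \<in> conv_layers d k (b (i - 1)) (b i)" "i - 1 \<noteq> N + 1" using N that by auto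
    then show ?thesis using False by (simp add: C'_def b'_def)
  qed
  moreover have "b' i \<in> {1..l}" if "i \<in> {1..<N + 1}" for i
    using that N assms(2) by (cases "i = N") (auto simp: b'_def)
  moreover have "b' 0 = c" "b' (N + 1) = c''" "1 \<le> N + 1" using N by (auto simp: b'_def)
  ultimately show ?thesis unfolding deep_cnns_def by blast
qed

subsection \<open>Uniform continuity on bounded sets\<close>

text \<open>A sup-norm bound over all indices, which is adequate because tensors in
  \<open>mtensors\<close> vanish off the box.\<close>

definition bounded_by :: "real \<Rightarrow> 'n mtensor \<Rightarrow> bool" where
  "bounded_by R z \<longleftrightarrow> (\<forall>j i. \<bar>z j i\<bar> \<le> R)"

lemma bounded_byD: "bounded_by R z \<Longrightarrow> \<bar>z j i\<bar> \<le> R"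
  by (simp add: bounded_by_def)

lemma bounded_by_nonneg: "bounded_by R z \<Longrightarrow> 0 \<le> R"
  by (metis abs_ge_zero bounded_by_def order_trans)

lemma bounded_by_mono: "bounded_by R z \<Longrightarrow> R \<le> R' \<Longrightarrow> bounded_by R' z"
  by (meson bounded_by_def order_trans)

lemma bounded_by_triangle:
  assumes "bounded_by r (x - y)" "bounded_by s (y - z)"
  shows "bounded_by (r + s) (x - z)"
  unfolding bounded_by_def
proof (intro allI)
  fix j i
  show "\<bar>(x - z) j i\<bar> \<le> r + s"
    using bounded_byD[OF assms(1), of j i] bounded_byD[OF assms(2), of j i] by (simp add: fun_diff_def)
qed

lemma bounded_by_commute: "bounded_by r (x - y) \<Longrightarrow> bounded_by r (y - x)"
  by (simp add: bounded_by_def fun_diff_def abs_minus_commute)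

lemma mtensors_bounded_by:
  assumes "z \<in> mtensors c d"
  shows "bounded_by (\<Sum>(j, i)\<in>{1..c} \<times> box_of d. \<bar>z j i\<bar>) z"
  unfolding bounded_by_def
proof (intro allI)
  fix j i
  let ?R = "\<Sum>(j, i)\<in>{1..c} \<times> box_of d. \<bar>z j i\<bar>"
  show "\<bar>z j i\<bar> \<le> ?R"
  proof (cases "(j, i) \<in> {1..c} \<times> box_of d")
    case True
    then show ?thesis
      using member_le_sum[of "(j, i)" "{1..c} \<times> box_of d" "\<lambda>(j, i). \<bar>z j i\<bar>"] by auto
  next
    case False
    then have "z j i = 0" using assms unfolding mtensors_def by blast
    moreover have "0 \<le> ?R" by (rule sum_nonneg) auto
    ultimately show ?thesis by simp
  qed
qed

text \<open>Uniform continuity on bounded sets and preservation of bounded sets are what composing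
  approximations takes: an approximant of the inner map ends up near, not in, the image of that
  map.\<close>

definition regular_map :: "'n mtensor set \<Rightarrow> ('n mtensor \<Rightarrow> 'n mtensor) \<Rightarrow> bool" where
  "regular_map S T \<longleftrightarrow> T \<in> S \<rightarrow> S \<and>
     (\<forall>R. \<exists>R'. \<forall>z\<in>S. bounded_by R z \<longrightarrow> bounded_by R' (T z)) \<and>
     (\<forall>R. \<forall>e>0. \<exists>r>0. \<forall>z\<in>S. \<forall>z'\<in>S. bounded_by R z \<longrightarrow> bounded_by R z' \<longrightarrow>
        bounded_by r (z - z') \<longrightarrow> bounded_by e (T z - T z'))"

lemma regular_mapD:
  assumes "regular_map S T"
  shows "z \<in> S \<Longrightarrow> T z \<in> S"
    and "\<exists>R'. \<forall>z\<in>S. bounded_by R z \<longrightarrow> bounded_by R' (T z)"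
    and "0 < e \<Longrightarrow> \<exists>r>0. \<forall>z\<in>S. \<forall>z'\<in>S. bounded_by R z \<longrightarrow> bounded_by R z' \<longrightarrow>
        bounded_by r (z - z') \<longrightarrow> bounded_by e (T z - T z')"
  using assms unfolding regular_map_def by blast+

lemma regular_map_comp:
  assumes F: "regular_map S F" and G: "regular_map S G"
  shows "regular_map S (F \<circ> G)"
  unfolding regular_map_def
proof (intro conjI allI impI)
  show "F \<circ> G \<in> S \<rightarrow> S" using regular_mapD(1)[OF F] regular_mapD(1)[OF G] by auto
  fix R
  obtain R' where R': "\<And>z. z \<in> S \<Longrightarrow> bounded_by R z \<Longrightarrow> bounded_by R' (G z)"
    using regular_mapD(2)[OF G] by blast
  obtain R'' where "\<And>z. z \<in> S \<Longrightarrow> bounded_by R' z \<Longrightarrow> bounded_by R'' (F z)"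
    using regular_mapD(2)[OF F] by blast
  then have "\<forall>z\<in>S. bounded_by R z \<longrightarrow> bounded_by R'' ((F \<circ> G) z)"
    using R' regular_mapD(1)[OF G] by simp
  then show "\<exists>R'. \<forall>z\<in>S. bounded_by R z \<longrightarrow> bounded_by R' ((F \<circ> G) z)" by (rule exI)
  fix e :: real assume "0 < e"
  obtain r where r: "0 < r" "\<And>z z'. z \<in> S \<Longrightarrow> z' \<in> S \<Longrightarrow> bounded_by R' z \<Longrightarrow> bounded_by R' z' \<Longrightarrow>
      bounded_by r (z - z') \<Longrightarrow> bounded_by e (F z - F z')"
    using regular_mapD(3)[OF F \<open>0 < e\<close>, of R'] by metis
  obtain r' where r': "0 < r'" "\<And>z z'. z \<in> S \<Longrightarrow> z' \<in> S \<Longrightarrow> bounded_by R z \<Longrightarrow> bounded_by R z' \<Longrightarrow>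
      bounded_by r' (z - z') \<Longrightarrow> bounded_by r (G z - G z')"
    using regular_mapD(3)[OF G \<open>0 < r\<close>, of R] by metis
  show "\<exists>r>0. \<forall>z\<in>S. \<forall>z'\<in>S. bounded_by R z \<longrightarrow> bounded_by R z' \<longrightarrow>
        bounded_by r (z - z') \<longrightarrow> bounded_by e ((F \<circ> G) z - (F \<circ> G) z')"
  proof (intro exI[of _ r'] conjI ballI impI r'(1))
    fix z z' assume "z \<in> S" "z' \<in> S" "bounded_by R z" "bounded_by R z'" "bounded_by r' (z - z')"
    then show "bounded_by e ((F \<circ> G) z - (F \<circ> G) z')"
      unfolding comp_apply by (intro r(2) r'(2) R' regular_mapD(1)[OF G])
  qed
qed

lemma regular_map_conv_layer:
  assumes "C \<in> conv_layers d k l l"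
  shows "regular_map (mtensors l d) C"
proof -
  obtain w \<delta> where C: "C = conv_layer d k l l w \<delta>" using assms by (auto simp: conv_layers_def)
  \<comment> \<open>The sum over all kernels dominates each row, so \<open>M\<close> is a Lipschitz
    constant in the sup norm.\<close>
  define M where "M = (\<Sum>i=1..l. \<Sum>j=1..l. \<Sum>e\<in>kernel_box k. \<bar>w i j e\<bar>)"
  have M: "0 \<le> M" by (simp add: M_def sum_nonneg)
  have lin: "\<bar>\<Sum>j=1..l. conv d k (w i j) (z j) m\<bar> \<le> M * R"
    if z: "bounded_by R z" and i: "i \<in> {1..l}" for z R i m
  proof -
    have "\<bar>\<Sum>j=1..l. conv d k (w i j) (z j) m\<bar> \<le> (\<Sum>j=1..l. (\<Sum>e\<in>kernel_box k. \<bar>w i j e\<bar>) * R)"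
      using bounded_byD[OF z] bounded_by_nonneg[OF z]
      by (intro order_trans[OF sum_abs] sum_mono conv_bound) auto
    also have "\<dots> = (\<Sum>j=1..l. \<Sum>e\<in>kernel_box k. \<bar>w i j e\<bar>) * R" by (simp add: sum_distrib_right)
    also have "\<dots> \<le> M * R"
      unfolding M_def using i bounded_by_nonneg[OF z]
      by (intro mult_right_mono member_le_sum) (auto simp: sum_nonneg)
    finally show ?thesis .
  qed
  show ?thesis
    unfolding regular_map_def
  proof (intro conjI allI impI)
    show "C \<in> mtensors l d \<rightarrow> mtensors l d" using conv_layer_in_mtensors[OF assms] by auto
    fix R :: real
    have "bounded_by (M * R + (\<Sum>i=1..l. \<bar>\<delta> i\<bar>)) (C z)" if z: "bounded_by R z" for z
      unfolding bounded_by_def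
    proof (intro allI)
      fix i m
      have nn: "0 \<le> M * R" "0 \<le> (\<Sum>i=1..l. \<bar>\<delta> i\<bar>)" using M bounded_by_nonneg[OF z] by (auto simp: sum_nonneg)
      show "\<bar>C z i m\<bar> \<le> M * R + (\<Sum>i=1..l. \<bar>\<delta> i\<bar>)"
      proof (cases "i \<in> {1..l}")
        case True
        have "\<bar>\<delta> i * ones d m\<bar> \<le> (\<Sum>i=1..l. \<bar>\<delta> i\<bar>)"
          using member_le_sum[OF True, of "\<lambda>i. \<bar>\<delta> i\<bar>"] nn by (simp add: ones_def)
        then show ?thesis using lin[OF z True, of m] True by (simp add: C conv_layer_def)
      next
        case False
        then show ?thesis using nn by (auto simp: C conv_layer_def)
      qed
    qed
    then show "\<exists>R'. \<forall>z\<in>mtensors l d. bounded_by R z \<longrightarrow> bounded_by R' (C z)" by blast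
    fix e :: real assume "0 < e"
    have "bounded_by e (C z - C z')" if z: "bounded_by (e / (M + 1)) (z - z')" for z z'
      unfolding bounded_by_def
    proof (intro allI)
      fix i m
      show "\<bar>(C z - C z') i m\<bar> \<le> e"
      proof (cases "i \<in> {1..l}")
        case True
        then have "(C z - C z') i m = (\<Sum>j=1..l. conv d k (w i j) ((z - z') j) m)"
          by (simp add: C conv_layer_def fun_diff_def sum_subtractf[symmetric] conv_diff)
        also have "\<bar>\<dots>\<bar> \<le> M * (e / (M + 1))" by (rule lin[OF z True])
        also have "\<dots> \<le> e" using M \<open>0 < e\<close> by (simp add: field_simps)
        finally show ?thesis .
      next
        case False
        then show ?thesis using \<open>0 < e\<close> by (auto simp: C conv_layer_def fun_diff_def)
      qed
    qed
    then show "\<exists>r>0. \<forall>z\<in>mtensors l d. \<forall>z'\<in>mtensors l d. bounded_by R z \<longrightarrow> bounded_by R z' \<longrightarrow>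
        bounded_by r (z - z') \<longrightarrow> bounded_by e (C z - C z')"
      using M \<open>0 < e\<close> by (intro exI[of _ "e / (M + 1)"]) auto
  qed
qed

lemma regular_map_act:
  assumes "continuous_on UNIV \<sigma>"
  shows "regular_map (mtensors l d) (act \<sigma> d l)"
  unfolding regular_map_def
proof (intro conjI allI impI)
  show "act \<sigma> d l \<in> mtensors l d \<rightarrow> mtensors l d" using act_in_mtensors by auto
  fix R :: real
  have "bounded (\<sigma> ` {-R..R})"
    by (intro compact_imp_bounded compact_continuous_image continuous_on_subset[OF assms]) auto
  then obtain M where M: "0 < M" "\<And>x. x \<in> {-R..R} \<Longrightarrow> \<bar>\<sigma> x\<bar> \<le> M" unfolding bounded_pos by auto
  have "bounded_by M (act \<sigma> d l z)" if "bounded_by R z" for z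
    unfolding bounded_by_def
  proof (intro allI)
    fix j i
    have "z j i \<in> {-R..R}" using bounded_byD[OF that, of j i] by auto
    then show "\<bar>act \<sigma> d l z j i\<bar> \<le> M" using M by (simp add: act_def)
  qed
  then show "\<exists>R'. \<forall>z\<in>mtensors l d. bounded_by R z \<longrightarrow> bounded_by R' (act \<sigma> d l z)" by blast
  fix e :: real assume "0 < e"
  have "uniformly_continuous_on {-R..R} \<sigma>"
    by (intro compact_uniformly_continuous continuous_on_subset[OF assms]) auto
  then obtain r where r: "0 < r" "\<And>x y. x \<in> {-R..R} \<Longrightarrow> y \<in> {-R..R} \<Longrightarrow> dist y x < r \<Longrightarrow> dist (\<sigma> y) (\<sigma> x) < e"
    unfolding uniformly_continuous_on_def using \<open>0 < e\<close> by blast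
  have "bounded_by e (act \<sigma> d l z - act \<sigma> d l z')"
    if z: "bounded_by R z" "bounded_by R z'" "bounded_by (r / 2) (z - z')" for z z'
    unfolding bounded_by_def
  proof (intro allI)
    fix j i
    have "z j i \<in> {-R..R}" "z' j i \<in> {-R..R}"
      using bounded_byD[OF z(1), of j i] bounded_byD[OF z(2), of j i] by auto
    moreover have "dist (z j i) (z' j i) < r"
      using bounded_byD[OF z(3), of j i] r(1) by (simp add: fun_diff_def dist_real_def)
    ultimately have "dist (\<sigma> (z j i)) (\<sigma> (z' j i)) < e" using r(2) by blast
    then show "\<bar>(act \<sigma> d l z - act \<sigma> d l z') j i\<bar> \<le> e"
      using \<open>0 < e\<close> by (simp add: act_def fun_diff_def dist_real_def)
  qed
  then show "\<exists>r>0. \<forall>z\<in>mtensors l d. \<forall>z'\<in>mtensors l d. bounded_by R z \<longrightarrow> bounded_by R z' \<longrightarrow>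
      bounded_by r (z - z') \<longrightarrow> bounded_by e (act \<sigma> d l z - act \<sigma> d l z')"
    using r(1) by (intro exI[of _ "r / 2"]) auto
qed

subsection \<open>Maps approximable by networks\<close>

text \<open>On increments of order \<open>h\<close> the error of the tangent is small compared with
  \<open>h\<close>, so it stays small after division by \<open>h * D\<close>. Thus the activation
  can be made to act almost as the identity on any bounded range.\<close>

lemma derivative_linearization:
  fixes f :: "real \<Rightarrow> real"
  assumes "(f has_field_derivative D) (at a)" "D \<noteq> 0" "0 < e"
  shows "\<exists>h>0. \<forall>s. \<bar>s\<bar> \<le> R \<longrightarrow> \<bar>(f (a + h * s) - f a) / (h * D) - s\<bar> \<le> e"
proof -
  define R' where "R' = \<bar>R\<bar> + 1"
  have R': "0 < R'" by (simp add: R'_def)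
  define e' where "e' = e * \<bar>D\<bar> / R'"
  have "0 < e'" using assms R' by (simp add: e'_def)
  then have "\<exists>r>0. \<forall>y. norm (y - a) < r \<longrightarrow> norm (f y - f a - D * (y - a)) \<le> e' * norm (y - a)"
    using assms(1) unfolding has_field_derivative_def has_derivative_at_alt by meson
  then obtain r where r: "0 < r" "\<And>y. \<bar>y - a\<bar> < r \<Longrightarrow> \<bar>f y - f a - D * (y - a)\<bar> \<le> e' * \<bar>y - a\<bar>"
    by auto
  define h where "h = r / (2 * R')"
  have h: "0 < h" "h * R' < r" using r R' by (auto simp: h_def)
  have "\<bar>(f (a + h * s) - f a) / (h * D) - s\<bar> \<le> e" if "\<bar>s\<bar> \<le> R" for s
  proof -
    have s: "\<bar>s\<bar> \<le> R'" using that by (simp add: R'_def)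
    then have hs: "\<bar>h * s\<bar> \<le> h * R'" using h by (simp add: abs_mult)
    have "(f (a + h * s) - f a) / (h * D) - s = (f (a + h * s) - f a - D * (h * s)) / (h * D)"
      using h assms by (simp add: field_simps)
    also have "\<bar>\<dots>\<bar> \<le> e' * (h * R') / (h * \<bar>D\<bar>)"
    proof -
      have "\<bar>f (a + h * s) - f a - D * (h * s)\<bar> \<le> e' * \<bar>h * s\<bar>" using r(2)[of "a + h * s"] hs h by simp
      also have "\<dots> \<le> e' * (h * R')" using hs \<open>0 < e'\<close> by simp
      finally have "\<bar>f (a + h * s) - f a - D * (h * s)\<bar> / (h * \<bar>D\<bar>) \<le> e' * (h * R') / (h * \<bar>D\<bar>)"
        using h by (intro divide_right_mono) auto
      then show ?thesis using h by (simp only: abs_divide abs_mult abs_of_pos)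
    qed
    also have "\<dots> = e" using h assms R' by (simp add: e'_def)
    finally show ?thesis .
  qed
  then show ?thesis using h by blast
qed

section \<open>Zero-padded shifts and matrix units\<close>

definition shift :: "nat ^ 'n::finite \<Rightarrow> 'n index \<Rightarrow> 'n tensor \<Rightarrow> 'n tensor" where
  "shift d v x i = (if i \<in> box_of d \<and> i - v \<in> box_of d then x (i - v) else 0)"

definition matrix_unit :: "'n index \<Rightarrow> 'n index \<Rightarrow> 'n tensor \<Rightarrow> 'n tensor" where
  "matrix_unit p q x i = (if i = p then x q else 0)"

text \<open>With zero padding, two shifts compose to the shift by the sum only if the intermediate
  index is in the box whenever both ends are. A step by the signs of \<open>v\<close> stays between
  the ends in every coordinate.\<close>

lemma shift_sgn_comp:
  "shift d (\<chi> t. sgn (v $ t)) (shift d (v - (\<chi> t. sgn (v $ t))) x) = shift d v x"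
proof
  fix i
  define s :: "'a index" where "s = (\<chi> t. sgn (v $ t))"
  have "i - s \<in> box_of d" if "i \<in> box_of d" "i - v \<in> box_of d"
    unfolding box_of_def
  proof (intro CollectI allI)
    fix t
    have "1 \<le> i $ t \<and> i $ t \<le> int (d $ t)" "1 \<le> i $ t - v $ t \<and> i $ t - v $ t \<le> int (d $ t)"
      using that by (auto simp: box_of_def)
    then show "1 \<le> (i - s) $ t \<and> (i - s) $ t \<le> int (d $ t)"
      by (auto simp: s_def sgn_if)
  qed
  moreover have "i - s - (v - s) = i - v" by simp
  ultimately show "shift d (\<chi> t. sgn (v $ t)) (shift d (v - (\<chi> t. sgn (v $ t))) x) i = shift d v x i"
    unfolding s_def[symmetric] by (auto simp: shift_def)
qed

text \<open>
  Shifting the entry at \<open>q\<close> to the lowest corner of the box and from there to the highest corner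
  pushes all other entries out of the box.
\<close>

lemma matrix_unit_shifts:
  fixes d :: "nat ^ 'n::finite"
  assumes p: "p \<in> box_of d" and q: "q \<in> box_of d"
  defines "u \<equiv> \<chi> t. int (d $ t)"
  shows "matrix_unit p q x = shift d (p - u) (shift d (u - 1) (shift d (1 - q) x))"
proof
  fix i
  have d: "1 \<le> int (d $ t)" for t
    using p unfolding box_of_def by (metis (mono_tags, lifting) mem_Collect_eq order_trans)
  have corner: "j = u" if "j \<in> box_of d" "j - (u - 1) \<in> box_of d" for j :: "'n index"
  proof (rule vec_eq_iff[THEN iffD2], intro allI)
    fix t
    show "j $ t = u $ t" using that by (auto simp: box_of_def u_def dest!: spec[of _ t])
  qed
  have box: "u \<in> box_of d" "1 \<in> box_of d" using d by (auto simp: box_of_def u_def)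
  show "matrix_unit p q x i = shift d (p - u) (shift d (u - 1) (shift d (1 - q) x)) i"
  proof (cases "i = p")
    case True
    then show ?thesis using p q box by (simp add: matrix_unit_def shift_def)
  next
    case False
    have "i - (p - u) \<noteq> u" using False by simp
    then have "shift d (u - 1) (shift d (1 - q) x) (i - (p - u)) = 0"
      using corner[of "i - (p - u)"] unfolding shift_def[of d "u - 1"] by presburger
    then have "shift d (p - u) (shift d (u - 1) (shift d (1 - q) x)) i = 0"
      unfolding shift_def[of d "p - u"] by simp
    then show ?thesis using False by (simp add: matrix_unit_def)
  qed
qed

section \<open>Approximation by networks of constant width and its closure properties\<close>

locale conv_net =
  fixes d k :: "nat ^ 'n::finite" and \<sigma> :: "real \<Rightarrow> real" and \<alpha> D :: real and l :: nat
  assumes k_pos: "1 \<le> k $ t"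
    and cont: "continuous_on UNIV \<sigma>"
    and deriv: "(\<sigma> has_field_derivative D) (at \<alpha>)" and D: "D \<noteq> 0"
begin

abbreviation S :: "'n mtensor set" where "S \<equiv> mtensors l d"

text \<open>
  The maps by which a network with \<open>l\<close> output channels can be extended. Composing two convolutional layers
  does not give one, so the second layer of a composition is preceded by the activation or is pointwise.
\<close>

inductive_set extensions :: "('n mtensor \<Rightarrow> 'n mtensor) set" where
  pointwise: "pointwise_layer d k l l A \<delta> \<in> extensions"
| layer: "C \<in> conv_layers d k l l \<Longrightarrow> C \<circ> act \<sigma> d l \<in> extensions"
| comp: "F \<in> extensions \<Longrightarrow> G \<in> extensions \<Longrightarrow> F \<circ> G \<in> extensions"

lemma extensions_deep_cnns:
  assumes "F \<in> extensions" "1 \<le> l" "f \<in> deep_cnns \<sigma> d k c l l"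
  shows "F \<circ> f \<in> deep_cnns \<sigma> d k c l l"
  using assms(1,3)
proof (induction arbitrary: f)
  case (pointwise A \<delta>)
  then show ?case by (rule deep_cnns_pointwise)
next
  case (layer C)
  then show ?case using assms(2) by (intro deep_cnns_act_layer) auto
next
  case (comp F G)
  then show ?case unfolding comp_assoc by blast
qed

lemma extensions_regular: "F \<in> extensions \<Longrightarrow> regular_map S F"
proof (induction rule: extensions.induct)
  case (pointwise A \<delta>)
  show ?case by (rule regular_map_conv_layer[OF pointwise_layer_in_conv_layers])
next
  case (layer C)
  then show ?case by (intro regular_map_comp regular_map_conv_layer regular_map_act cont)
next
  case (comp F G)
  then show ?case by (intro regular_map_comp)
qed

text \<open>The closure of \<open>extensions\<close> for uniform convergence on bounded subsets of
  \<open>S\<close>.\<close>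

definition approximable :: "('n mtensor \<Rightarrow> 'n mtensor) \<Rightarrow> bool" where
  "approximable T \<longleftrightarrow> (\<forall>R. \<forall>e>0. \<exists>F\<in>extensions. \<forall>z\<in>S. bounded_by R z \<longrightarrow> bounded_by e (F z - T z))"

lemma approximableD:
  assumes "approximable T" "0 < e"
  obtains F where "F \<in> extensions" "\<And>z. z \<in> S \<Longrightarrow> bounded_by R z \<Longrightarrow> bounded_by e (F z - T z)"
  using assms unfolding approximable_def by metis

lemma approximable_extension: "F \<in> extensions \<Longrightarrow> approximable F"
  unfolding approximable_def bounded_by_def by (intro allI impI bexI[of _ F]) auto

lemma approximable_cong:
  assumes "approximable T" "\<And>z. z \<in> S \<Longrightarrow> T' z = T z"
  shows "approximable T'"
  using assms unfolding approximable_def by simp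

lemma approximable_limit:
  assumes "\<And>R e. 0 < e \<Longrightarrow> \<exists>T'. approximable T' \<and> (\<forall>z\<in>S. bounded_by R z \<longrightarrow> bounded_by e (T' z - T z))"
  shows "approximable T"
  unfolding approximable_def
proof (intro allI impI)
  fix R e :: real assume "0 < e"
  obtain T' where T': "approximable T'" "\<And>z. z \<in> S \<Longrightarrow> bounded_by R z \<Longrightarrow> bounded_by (e / 2) (T' z - T z)"
    using assms[of "e / 2" R] \<open>0 < e\<close> by auto
  obtain F where F: "F \<in> extensions" "\<And>z. z \<in> S \<Longrightarrow> bounded_by R z \<Longrightarrow> bounded_by (e / 2) (F z - T' z)"
    using approximableD[OF T'(1), of "e / 2"] \<open>0 < e\<close> by (metis half_gt_zero)
  have "bounded_by e (F z - T z)" if "z \<in> S" "bounded_by R z" for z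
    using bounded_by_triangle[OF F(2)[OF that] T'(2)[OF that]] by simp
  then show "\<exists>F\<in>extensions. \<forall>z\<in>S. bounded_by R z \<longrightarrow> bounded_by e (F z - T z)"
    using F(1) by blast
qed

text \<open>Regularity survives uniform limits on bounded sets by a three-epsilon argument. It is
  needed because operations on a single channel are obtained as limits of extensions and still have
  to be composed.\<close>

lemma approximable_regular:
  assumes T: "approximable T"
  shows "regular_map S T"
  unfolding regular_map_def
proof (intro conjI allI impI)
  show "T \<in> S \<rightarrow> S"
  proof
    fix z assume z: "z \<in> S"
    obtain R where R: "bounded_by R z" using mtensors_bounded_by[OF z] by blast
    have "T z j i = 0" if ji: "\<not> (j \<in> {1..l} \<and> i \<in> box_of d)" for j i
    proof (rule ccontr)
      \<comment> \<open>Every extension vanishes at this index, so a nonzero value would keep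
        \<open>T z\<close> at distance at least \<open>2 * e\<close> from all of them.\<close>
      assume nz: "T z j i \<noteq> 0"
      define e where "e = \<bar>T z j i\<bar> / 2"
      have "0 < e" using nz by (simp add: e_def)
      then obtain F where F: "F \<in> extensions" "\<And>z. z \<in> S \<Longrightarrow> bounded_by R z \<Longrightarrow> bounded_by e (F z - T z)"
        using approximableD[OF T] by metis
      have "F z \<in> S" using regular_mapD(1)[OF extensions_regular[OF F(1)] z] .
      then have "F z j i = 0" using ji unfolding mtensors_def by blast
      then show False using bounded_byD[OF F(2)[OF z R], of j i] nz by (simp add: fun_diff_def e_def)
    qed
    then show "T z \<in> S" unfolding mtensors_def by blast
  qed
  fix R :: real
  obtain F where F: "F \<in> extensions" "\<And>z. z \<in> S \<Longrightarrow> bounded_by R z \<Longrightarrow> bounded_by 1 (F z - T z)"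
    using approximableD[OF T zero_less_one, of R] by metis
  obtain R' where R': "\<And>z. z \<in> S \<Longrightarrow> bounded_by R z \<Longrightarrow> bounded_by R' (F z)"
    using regular_mapD(2)[OF extensions_regular[OF F(1)], of R] by metis
  have "bounded_by (R' + 1) (T z)" if z: "z \<in> S" "bounded_by R z" for z
    unfolding bounded_by_def
  proof (intro allI)
    fix j i
    show "\<bar>T z j i\<bar> \<le> R' + 1"
      using bounded_byD[OF R'[OF z], of j i] bounded_byD[OF F(2)[OF z], of j i] by (simp add: fun_diff_def)
  qed
  then show "\<exists>R'. \<forall>z\<in>S. bounded_by R z \<longrightarrow> bounded_by R' (T z)" by blast
  fix e :: real assume "0 < e"
  then have e3: "0 < e / 3" by simp
  obtain G where G: "G \<in> extensions" "\<And>z. z \<in> S \<Longrightarrow> bounded_by R z \<Longrightarrow> bounded_by (e / 3) (G z - T z)"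
    using approximableD[OF T e3, of R] by metis
  obtain r where r: "0 < r" "\<And>z z'. z \<in> S \<Longrightarrow> z' \<in> S \<Longrightarrow> bounded_by R z \<Longrightarrow> bounded_by R z' \<Longrightarrow>
      bounded_by r (z - z') \<Longrightarrow> bounded_by (e / 3) (G z - G z')"
    using regular_mapD(3)[OF extensions_regular[OF G(1)] e3, of R] by metis
  show "\<exists>r>0. \<forall>z\<in>S. \<forall>z'\<in>S. bounded_by R z \<longrightarrow> bounded_by R z' \<longrightarrow>
        bounded_by r (z - z') \<longrightarrow> bounded_by e (T z - T z')"
  proof (intro exI[of _ r] conjI ballI impI r(1))
    fix z z' assume z: "z \<in> S" "z' \<in> S" "bounded_by R z" "bounded_by R z'" "bounded_by r (z - z')"
    have "bounded_by (e / 3 + (e / 3 + e / 3)) (T z - T z')"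
      by (rule bounded_by_triangle[OF bounded_by_commute[OF G(2)[OF z(1,3)]]
            bounded_by_triangle[OF r(2)[OF z] G(2)[OF z(2,4)]]])
    then show "bounded_by e (T z - T z')" by simp
  qed
qed

text \<open>\<open>G\<close> approximates \<open>U\<close> within \<open>min r 1\<close>: within 1
  so that \<open>G z\<close> lies where \<open>F\<close> is close to \<open>T\<close>, within
  \<open>r\<close> so that \<open>T\<close> changes little between \<open>U z\<close> and
  \<open>G z\<close>. The separate \<open>V\<close> allows the composite to be stated in simplified
  form, valid on \<open>S\<close>.\<close>

lemma approximable_comp:
  assumes T: "approximable T" and U: "approximable U" and V: "\<And>z. z \<in> S \<Longrightarrow> V z = T (U z)"
  shows "approximable V"
  unfolding approximable_def
proof (intro allI impI)
  fix R e :: real assume "0 < e"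
  then have e2: "0 < e / 2" by simp
  obtain R' where R': "\<And>z. z \<in> S \<Longrightarrow> bounded_by R z \<Longrightarrow> bounded_by R' (U z)"
    using regular_mapD(2)[OF approximable_regular[OF U], of R] by metis
  obtain r where r: "0 < r" "\<And>z z'. z \<in> S \<Longrightarrow> z' \<in> S \<Longrightarrow> bounded_by (R' + 1) z \<Longrightarrow> bounded_by (R' + 1) z' \<Longrightarrow>
      bounded_by r (z - z') \<Longrightarrow> bounded_by (e / 2) (T z - T z')"
    using regular_mapD(3)[OF approximable_regular[OF T] e2, of "R' + 1"] by metis
  obtain F where F: "F \<in> extensions" "\<And>z. z \<in> S \<Longrightarrow> bounded_by (R' + 1) z \<Longrightarrow> bounded_by (e / 2) (F z - T z)"
    using approximableD[OF T e2, of "R' + 1"] by metis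
  have "0 < min r 1" using r(1) by simp
  then obtain G where G: "G \<in> extensions" "\<And>z. z \<in> S \<Longrightarrow> bounded_by R z \<Longrightarrow> bounded_by (min r 1) (G z - U z)"
    using approximableD[OF U, of "min r 1" R] by metis
  have "bounded_by e ((F \<circ> G) z - V z)" if z: "z \<in> S" "bounded_by R z" for z
  proof -
    have mem: "G z \<in> S" "U z \<in> S"
      using regular_mapD(1)[OF extensions_regular[OF G(1)]] regular_mapD(1)[OF approximable_regular[OF U]] z by auto
    have b: "bounded_by (R' + 1) (U z)" by (rule bounded_by_mono[OF R'[OF z]]) simp
    have b': "bounded_by (R' + 1) (G z)"
      unfolding bounded_by_def
    proof (intro allI)
      fix j i
      have "\<bar>G z j i - U z j i\<bar> \<le> 1" using bounded_byD[OF G(2)[OF z], of j i] by (simp add: fun_diff_def)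
      then show "\<bar>G z j i\<bar> \<le> R' + 1" using bounded_byD[OF R'[OF z], of j i] by linarith
    qed
    have "bounded_by r (G z - U z)" by (rule bounded_by_mono[OF G(2)[OF z]]) simp
    from bounded_by_triangle[OF F(2)[OF mem(1) b'] r(2)[OF mem b' b this]]
    show ?thesis using V[OF z(1)] by simp
  qed
  then show "\<exists>F\<in>extensions. \<forall>z\<in>S. bounded_by R z \<longrightarrow> bounded_by e (F z - V z)"
    using extensions.comp[OF F(1) G(1)] by blast
qed

section \<open>Elementary operations on a single channel\<close>

lemma approximable_update:
  assumes "ch \<in> {1..l}" "p \<in> {1..l}" "q \<in> {1..l}"
  shows "approximable (\<lambda>z. z(ch := (\<lambda>m. if m \<in> box_of d then a * z p m + b * z q m + c else 0)))"
proof (rule approximable_cong[OF approximable_extension[OF extensions.pointwise]])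
  fix z assume z: "z \<in> S"
  \<comment> \<open>A sum of two conditionals covers the case \<open>p = q\<close>, where the
    coefficients add up.\<close>
  let ?A = "\<lambda>i j. if i = ch then (if j = p then a else 0) + (if j = q then b else 0) else if j = i then 1 else 0 :: real"
  let ?\<delta> = "\<lambda>i. if i = ch then c else 0"
  have "(z(ch := (\<lambda>m. if m \<in> box_of d then a * z p m + b * z q m + c else 0))) i m
      = pointwise_layer d k l l ?A ?\<delta> z i m" for i m
  proof (cases "i \<in> {1..l} \<and> m \<in> box_of d")
    case True
    have "(\<Sum>j=1..l. ?A i j * z j m) = (if i = ch then a * z p m + b * z q m else z i m)"
      using assms True by (auto simp: distrib_right sum.distrib if_distrib[of "\<lambda>x. x * _"] cong: if_cong)
    then show ?thesis using True by (simp add: pointwise_layer_apply)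
  next
    case False
    then have "z i m = 0" by (rule mtensorsD[OF z])
    moreover have "i \<noteq> ch \<or> m \<notin> box_of d" using False assms by auto
    ultimately show ?thesis unfolding pointwise_layer_apply using False by auto
  qed
  then show "z(ch := (\<lambda>m. if m \<in> box_of d then a * z p m + b * z q m + c else 0))
      = pointwise_layer d k l l ?A ?\<delta> z" by (intro ext)
qed

text \<open>All channels pass through the activation at once. Channel \<open>ch\<close> does so
  unscaled; the others are squeezed into the nearly linear range at \<open>\<alpha>\<close> and
  restored by inverting the linearization.\<close>

lemma approximable_activation:
  assumes "ch \<in> {1..l}"
  shows "approximable (\<lambda>z. z(ch := (\<lambda>m. if m \<in> box_of d then \<sigma> (z ch m) else 0)))"
  unfolding approximable_def
proof (intro allI impI)
  fix R e :: real assume "0 < e"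
  obtain h where h: "0 < h" "\<And>s. \<bar>s\<bar> \<le> R \<Longrightarrow> \<bar>(\<sigma> (\<alpha> + h * s) - \<sigma> \<alpha>) / (h * D) - s\<bar> \<le> e"
    using derivative_linearization[OF deriv D \<open>0 < e\<close>, of R] by metis
  let ?A = "\<lambda>i j. if j = i then if i = ch then 1 else h else 0"
  let ?a = "\<lambda>i. if i = ch then 0 else \<alpha>"
  let ?B = "\<lambda>i j. if j = i then if i = ch then 1 else 1 / (h * D) else 0"
  let ?b = "\<lambda>i. if i = ch then 0 else - \<sigma> \<alpha> / (h * D)"
  define F where "F = pointwise_layer d k l l ?B ?b \<circ> act \<sigma> d l \<circ> pointwise_layer d k l l ?A ?a"
  have "F \<in> extensions"
    unfolding F_def by (intro extensions.intros pointwise_layer_in_conv_layers)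
  moreover have "bounded_by e (F z - z(ch := (\<lambda>m. if m \<in> box_of d then \<sigma> (z ch m) else 0)))"
    if z: "z \<in> S" "bounded_by R z" for z
    unfolding bounded_by_def
  proof (intro allI)
    fix i m
    show "\<bar>(F z - z(ch := (\<lambda>m. if m \<in> box_of d then \<sigma> (z ch m) else 0))) i m\<bar> \<le> e"
    proof (cases "i \<in> {1..l} \<and> m \<in> box_of d")
      case True
      then have "F z i m = (if i = ch then \<sigma> (z ch m) else (\<sigma> (\<alpha> + h * z i m) - \<sigma> \<alpha>) / (h * D))"
        by (simp add: F_def pointwise_layer_apply act_def if_distrib[of "\<lambda>x. x * _"] diff_divide_distrib add.commute cong: if_cong)
      then show ?thesis using True \<open>0 < e\<close> h(2)[OF bounded_byD[OF z(2), of i m]] by (simp add: fun_diff_def)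
    next
      case False
      then have "z i m = 0" by (rule mtensorsD[OF z(1)])
      moreover have "i \<noteq> ch \<or> m \<notin> box_of d" using False assms by auto
      moreover have "F z i m = 0" unfolding F_def comp_apply pointwise_layer_apply using False by auto
      ultimately show ?thesis using \<open>0 < e\<close> by (auto simp: fun_diff_def)
    qed
  qed
  ultimately show "\<exists>F\<in>extensions. \<forall>z\<in>S. bounded_by R z \<longrightarrow>
      bounded_by e (F z - z(ch := (\<lambda>m. if m \<in> box_of d then \<sigma> (z ch m) else 0)))" by blast
qed

text \<open>
  Zero padding turns the constant \<open>\<sigma> \<alpha>\<close> that comes with the linearization of \<open>\<sigma>\<close> at \<open>\<alpha>\<close> into a
  non-constant tensor, which no bias can remove. So the channel is encoded as the difference of two
  channels, and only this difference is convolved.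
\<close>

lemma approximable_conv:
  assumes ch: "ch \<in> {1..l}" "u \<in> {1..l}" "ch \<noteq> u"
  shows "approximable (\<lambda>z. z(ch := conv d k w (z ch)))"
  unfolding approximable_def
proof (intro allI impI)
  fix R e :: real assume "0 < e"
  define M where "M = (\<Sum>v\<in>kernel_box k. \<bar>w v\<bar>)"
  have M: "0 \<le> M" by (simp add: M_def sum_nonneg)
  \<comment> \<open>The encoded difference involves two linearizations, hence an error
    \<open>2 * e'\<close> per entry, multiplied by the kernel norm \<open>M\<close>. The extra 1
    yields \<open>e' \<le> e\<close> for the channels that are merely carried along.\<close>
  define e' where "e' = e / (2 * M + 1)"
  have e': "0 < e'" "2 * M * e' \<le> e" "e' \<le> e"
    using M \<open>0 < e\<close> by (auto simp: e'_def field_simps)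
  define L where "L h s = (\<sigma> (\<alpha> + h * s) - \<sigma> \<alpha>) / (h * D)" for h s
  obtain h where h: "0 < h" "\<And>s. \<bar>s\<bar> \<le> 2 * R \<Longrightarrow> \<bar>L h s - s\<bar> \<le> e'"
    using derivative_linearization[OF deriv D e'(1), of "2 * R"] unfolding L_def by metis
  \<comment> \<open>Up to scaling, channel \<open>ch\<close> carries \<open>z ch + z u\<close> and
    channel \<open>u\<close> carries \<open>z u\<close>. The kernels \<open>w\<close> and
    \<open>- w\<close> in \<open>?B\<close> act on their difference, in which
    \<open>\<sigma> \<alpha>\<close> cancels.\<close>
  let ?A = "\<lambda>i j. (if j = i then h else 0) + (if j = u then if i = ch then h else 0 else 0)"
  let ?B = "\<lambda>i j. if i = ch then if j = ch then (\<lambda>v. w v) else if j = u then (\<lambda>v. - w v) else (\<lambda>v. 0)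
      else (\<lambda>v. if v = 0 then if j = i then 1 else 0 else 0)"
  let ?B' = "\<lambda>i j v. 1 / (h * D) * ?B i j v"
  let ?b = "\<lambda>i. if i = ch then 0 else - \<sigma> \<alpha> / (h * D)"
  define F where "F = conv_layer d k l l ?B' ?b \<circ> act \<sigma> d l \<circ> pointwise_layer d k l l ?A (\<lambda>i. \<alpha>)"
  have "conv_layer d k l l ?B' ?b \<in> conv_layers d k l l" unfolding conv_layers_def by blast
  then have "F \<in> extensions" unfolding F_def by (intro extensions.intros)
  moreover have "bounded_by e (F z - z(ch := conv d k w (z ch)))"
    if z: "z \<in> S" "bounded_by R z" for z
    unfolding bounded_by_def
  proof (intro allI)
    fix i m
    note R = bounded_by_nonneg[OF z(2)] bounded_byD[OF z(2)]
    define y where "y = act \<sigma> d l (pointwise_layer d k l l ?A (\<lambda>i. \<alpha>) z)"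
    have y: "y i m = \<sigma> (\<alpha> + h * (z i m + (if i = ch then z u m else 0)))"
      if "i \<in> {1..l}" "m \<in> box_of d" for i m
      using that ch by (simp add: y_def act_def pointwise_layer_apply distrib_right distrib_left sum.distrib
          if_distrib[of "\<lambda>x. x * _"] add_ac cong: if_cong)
    have F: "F z i m = 1 / (h * D) * (\<Sum>j=1..l. conv d k (?B i j) (y j) m) + ?b i"
      if "i \<in> {1..l}" "m \<in> box_of d"
    proof -
      have "conv d k (?B' i j) (y j) m = 1 / (h * D) * conv d k (?B i j) (y j) m" for j
        using conv_kernel_sum[where J = "{()}" and A = "\<lambda>_. 1 / (h * D)" and w = "\<lambda>_. ?B i j"] by simp
      then show ?thesis
        using that by (simp add: F_def y_def[symmetric] conv_layer_def ones_def sum_distrib_left)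
    qed
    show "\<bar>(F z - z(ch := conv d k w (z ch))) i m\<bar> \<le> e"
    proof (cases "i \<in> {1..l} \<and> m \<in> box_of d")
      case im: True
      show ?thesis
      proof (cases "i = ch")
        case True
        have "(\<Sum>j=1..l. conv d k (?B i j) (y j) m)
            = (\<Sum>j=1..l. (if j = ch then conv d k w (y ch) m else 0) - (if j = u then conv d k w (y u) m else 0))"
        proof (rule sum.cong)
          fix j
          have "conv d k (\<lambda>v. - w v) (y u) m = - conv d k w (y u) m"
            by (simp add: conv_def sum_negf)
          then show "conv d k (?B i j) (y j) m = (if j = ch then conv d k w (y ch) m else 0) - (if j = u then conv d k w (y u) m else 0)"
            using True ch(3) by simp
        qed simp
        also have "\<dots> = conv d k w (\<lambda>m. y ch m - y u m) m"
          using ch by (simp add: sum_subtractf conv_diff)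
        finally have "F z i m = 1 / (h * D) * conv d k w (\<lambda>m. y ch m - y u m) m" using F im True by simp
        also have "\<dots> = conv d k w (\<lambda>m. 1 / (h * D) * (y ch m - y u m)) m"
          by (auto simp: conv_def sum_divide_distrib intro!: sum.cong)
        also have "\<dots> = conv d k w (\<lambda>m. L h (z ch m + z u m) - L h (z u m)) m"
          using ch by (intro conv_cong) (simp add: y L_def diff_divide_distrib)
        finally have "F z i m - conv d k w (z ch) m = conv d k w (\<lambda>m. (L h (z ch m + z u m) - L h (z u m)) - z ch m) m"
          by (simp add: conv_diff)
        also have "\<bar>\<dots>\<bar> \<le> M * (2 * e')"
          unfolding M_def
        proof (rule conv_bound)
          fix m
          have "\<bar>z ch m + z u m\<bar> \<le> 2 * R" "\<bar>z u m\<bar> \<le> 2 * R" using R(1) R(2)[of ch m] R(2)[of u m] by linarith+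
          from h(2)[OF this(1)] h(2)[OF this(2)]
          show "\<bar>L h (z ch m + z u m) - L h (z u m) - z ch m\<bar> \<le> 2 * e'" by linarith
        qed (use e' in simp)
        finally show ?thesis using True e' by (simp add: fun_diff_def mult_ac)
      next
        case False
        have "(\<Sum>j=1..l. conv d k (?B i j) (y j) m) = (\<Sum>j=1..l. if j = i then y i m else 0)"
          using False im by (intro sum.cong) (auto simp: conv_pointwise)
        then have "F z i m = L h (z i m)"
          using F im False y[of i m] by (simp add: L_def diff_divide_distrib)
        moreover have "\<bar>z i m\<bar> \<le> 2 * R" using R(1) R(2)[of i m] by linarith
        ultimately show ?thesis using h(2)[of "z i m"] e' False by (simp add: fun_diff_def)
      qed
    next
      case False
      then have "z i m = 0" by (rule mtensorsD[OF z(1)])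
      moreover have "i = ch \<Longrightarrow> conv d k w (z ch) m = 0" using False ch by (auto simp: conv_def)
      moreover have "F z i m = 0"
        using False unfolding F_def comp_apply conv_layer_def by (auto simp: conv_def ones_def)
      ultimately show ?thesis using \<open>0 < e\<close> by (auto simp: fun_diff_def)
    qed
  qed
  ultimately show "\<exists>F\<in>extensions. \<forall>z\<in>S. bounded_by R z \<longrightarrow>
      bounded_by e (F z - z(ch := conv d k w (z ch)))" by blast
qed

text \<open>By \<open>k_pos\<close> the kernel box contains every vector with coordinates in
  \<open>{-1, 0, 1}\<close>. Subtracting the signs of \<open>v\<close> brings all its nonzero
  coordinates one closer to 0, which gives an induction.\<close>

lemma approximable_shift:
  assumes ch: "ch \<in> {1..l}" "u \<in> {1..l}" "ch \<noteq> u"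
  shows "approximable (\<lambda>z. z(ch := shift d v (z ch)))"
proof -
  have small: "approximable (\<lambda>z. z(ch := shift d v (z ch)))" if "v \<in> kernel_box k" for v
  proof -
    have "shift d v x = conv d k (\<lambda>e. if e = v then 1 else 0) x" for x
      by (rule ext) (simp add: shift_def conv_single[OF that])
    then show ?thesis using approximable_conv[OF ch] by simp
  qed
  have "approximable (\<lambda>z. z(ch := shift d v (z ch)))" if "\<And>t. \<bar>v $ t\<bar> \<le> int n" for v n
    using that
  proof (induction n arbitrary: v)
    case 0
    then have "v \<in> kernel_box k" by (simp add: kernel_box_def)
    then show ?case by (rule small)
  next
    case (Suc n)
    let ?s = "(\<chi> t. sgn (v $ t)) :: 'n index"
    have "?s \<in> kernel_box k"
      using k_pos by (auto simp: kernel_box_def sgn_if intro: order_trans)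
    moreover have "\<bar>(v - ?s) $ t\<bar> \<le> int n" for t
      using Suc.prems[of t] by (auto simp: sgn_if)
    ultimately show ?case
      by (rule approximable_comp[OF small Suc.IH]) (simp only: shift_sgn_comp fun_upd_same fun_upd_upd)
  qed
  moreover have "\<bar>v $ t\<bar> \<le> int (nat (\<Sum>t\<in>UNIV. \<bar>v $ t\<bar>))" for t
    using member_le_sum[of t UNIV "\<lambda>t. \<bar>v $ t\<bar>"] by simp
  ultimately show ?thesis by blast
qed

lemma approximable_matrix_unit:
  assumes ch: "ch \<in> {1..l}" "u \<in> {1..l}" "ch \<noteq> u" and "p \<in> box_of d" "q \<in> box_of d"
  shows "approximable (\<lambda>z. z(ch := matrix_unit p q (z ch)))"
  unfolding matrix_unit_shifts[OF assms(4,5)]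
  by (rule approximable_comp[OF approximable_comp[OF approximable_shift[OF ch] approximable_shift[OF ch]]
        approximable_shift[OF ch]])
    auto

end

subsection \<open>Adding exponentials of linear forms to the output\<close>

text \<open>
  The input is held by the channels \<open>1, \<dots>, n\<close>, the register by channel \<open>P\<close>, and channel \<open>T\<close> is
  scratch space.
\<close>

locale register_net = conv_net d k \<sigma> \<alpha> D l
  for d k :: "nat ^ 'n::finite" and \<sigma> :: "real \<Rightarrow> real" and \<alpha> D :: real and l :: nat +
  fixes P T n :: nat
  assumes PT: "P \<in> {1..l}" "T \<in> {1..l}" "P \<noteq> T" and n: "n < P" "n < T"
    and nonaff: "\<not> (\<exists>a b. \<forall>x. \<sigma> x = a * x + b)"
begin

lemma n_le: "a \<le> n \<Longrightarrow> a \<noteq> P \<and> a \<noteq> T \<and> a \<le> l"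
  using n PT by auto

lemma approximable_clear: "ch \<in> {1..l} \<Longrightarrow> approximable (\<lambda>z. z(ch := (\<lambda>m. 0)))"
  by (rule approximable_cong[OF approximable_update[of ch ch ch 0 0 0]]) (auto simp: fun_eq_iff)

lemma approximable_copy:
  assumes "ch \<in> {1..l}" "a \<in> {1..l}"
  shows "approximable (\<lambda>z. z(ch := z a))"
proof (rule approximable_cong[OF approximable_update[of ch a a 1 0 0]])
  fix z assume "z \<in> S"
  then have "z a = (\<lambda>m. if m \<in> box_of d then 1 * z a m + 0 * z a m + 0 else 0)"
    by (auto simp: fun_eq_iff mtensorsD)
  then show "z(ch := z a) = z(ch := (\<lambda>m. if m \<in> box_of d then 1 * z a m + 0 * z a m + 0 else 0))" by simp
qed (use assms in auto)

lemma approximable_add_multiple: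
  assumes "ch \<in> {1..l}" "a \<in> {1..l}"
  shows "approximable (\<lambda>z. z(ch := (\<lambda>m. z ch m + c * z a m)))"
proof (rule approximable_cong[OF approximable_update[of ch ch a 1 c 0]])
  fix z assume z: "z \<in> S"
  have "z ch m + c * z a m = (if m \<in> box_of d then 1 * z ch m + c * z a m + 0 else 0)" for m
    using mtensorsD[OF z, of ch m] mtensorsD[OF z, of a m] by auto
  then show "z(ch := (\<lambda>m. z ch m + c * z a m))
      = z(ch := (\<lambda>m. if m \<in> box_of d then 1 * z ch m + c * z a m + 0 else 0))" by simp
qed (use assms in auto)

text \<open>The scratch channel receives a copy of \<open>a\<close>, is reduced to one entry, and is
  added to \<open>b\<close>. Reducing it takes a second channel for the difference encoding; the
  register serves as such and keeps its content.\<close>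

lemma approximable_add_entry:
  assumes a: "a \<in> {1..l}" and b: "b \<in> {1..l}" "b \<noteq> T" and p: "p \<in> box_of d" and q: "q \<in> box_of d"
  shows "approximable (\<lambda>z. z(b := (\<lambda>m. z b m + (if m = p then c * z a q else 0)), T := (\<lambda>m. 0)))"
proof (rule approximable_comp[OF approximable_clear[OF PT(2)] approximable_comp[OF approximable_add_multiple
        approximable_comp[OF approximable_matrix_unit[OF PT(2,1) _ p q] approximable_copy[OF PT(2) a]]]])
  show "z(b := (\<lambda>m. z b m + (if m = p then c * z a q else 0)), T := (\<lambda>m. 0))
    = (z(T := matrix_unit p q (z a), b := (\<lambda>m. z b m + c * matrix_unit p q (z a) m)))(T := (\<lambda>m. 0))" for z
    using b by (auto simp: matrix_unit_def fun_eq_iff)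
  show "z(T := matrix_unit p q (z a), b := (\<lambda>m. z b m + c * matrix_unit p q (z a) m))
      = (z(T := matrix_unit p q (z a)))
         (b := \<lambda>m. (z(T := matrix_unit p q (z a))) b m + c * (z(T := matrix_unit p q (z a))) T m)" for z
    using b by simp
qed (use PT b in auto)

definition lin :: "(nat \<Rightarrow> 'n index \<Rightarrow> real) \<Rightarrow> 'n mtensor \<Rightarrow> real" where
  "lin v z = (\<Sum>(a, q)\<in>{1..n} \<times> box_of d. v a q * z a q)"

lemma lin_cong: "(\<And>a. a \<le> n \<Longrightarrow> z a = z' a) \<Longrightarrow> lin v z = lin v z'"
  unfolding lin_def by (intro sum.cong) auto

lemma lin_update [simp]: "n < ch \<Longrightarrow> lin v (z(ch := t)) = lin v z"
  by (rule lin_cong) simp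

lemma lin_scale: "lin (\<lambda>a q. s * v a q) z = s * lin v z"
  by (simp add: lin_def sum_distrib_left split_def mult.assoc)

lemma approximable_add_lin:
  assumes p: "p \<in> box_of d"
  shows "approximable (\<lambda>z. z(P := (\<lambda>m. z P m + (if m = p then lin v z else 0)), T := (\<lambda>m. 0)))"
proof -
  \<comment> \<open>Generalized to partial sums for the induction: adding a summand changes only
    \<open>P\<close> and \<open>T\<close>, while the remaining ones read channels up to
    \<open>n\<close>.\<close>
  have "approximable (\<lambda>z. z(P := (\<lambda>m. z P m + (if m = p then \<Sum>(a, q)\<in>A. v a q * z a q else 0)), T := (\<lambda>m. 0)))"
    if "finite A" "A \<subseteq> {1..n} \<times> box_of d" for A
    using that
  proof (induction A)
    case empty
    show ?case by (rule approximable_cong[OF approximable_clear[OF PT(2)]]) (simp add: fun_eq_iff)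
  next
    case (insert x A)
    obtain a q where x: "x = (a, q)" by (cases x)
    then have a: "a \<in> {1..l}" "a \<noteq> P" "a \<noteq> T" and q: "q \<in> box_of d" using insert.prems n_le[of a] by auto
    have A: "a' \<noteq> P" "a' \<noteq> T" if "(a', q') \<in> A" for a' q' using insert.prems n_le[of a'] that by auto
    have IH: "approximable (\<lambda>z. z(P := (\<lambda>m. z P m + (if m = p then \<Sum>(a, q)\<in>A. v a q * z a q else 0)), T := (\<lambda>m. 0)))"
      using insert by blast
    show ?case
    proof (rule approximable_comp[OF IH approximable_add_entry[OF a(1) PT(1,3) p q, of "v a q"]])
      fix z
      let ?z = "z(P := (\<lambda>m. z P m + (if m = p then v a q * z a q else 0)), T := (\<lambda>m. 0))"
      have "(\<Sum>(a, q)\<in>A. v a q * ?z a q) = (\<Sum>(a, q)\<in>A. v a q * z a q)"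
        using A by (intro sum.cong) auto
      then show "z(P := (\<lambda>m. z P m + (if m = p then \<Sum>(a, q)\<in>insert x A. v a q * z a q else 0)), T := (\<lambda>m. 0))
        = ?z(P := (\<lambda>m. ?z P m + (if m = p then \<Sum>(a, q)\<in>A. v a q * ?z a q else 0)), T := (\<lambda>m. 0))"
        using insert.hyps PT(3) by (simp add: x fun_eq_iff)
    qed
  qed
  from this[of "{1..n} \<times> box_of d"] show ?thesis unfolding lin_def by simp
qed

text \<open>The activation acts on whole channels, so every position undergoes the gate. The linear
  form is present at \<open>p\<close> only; the other positions run with parameter 0.\<close>

lemma approximable_gate:
  assumes p: "p \<in> box_of d"
  shows "approximable (\<lambda>z. z(P := (\<lambda>m. if m \<in> box_of d then gate \<sigma> a (if m = p then lin v z else 0) (z P m) else 0),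
    T := (\<lambda>m. 0)))"
proof -
  obtain c w \<theta> s where a: "a = (c, w, \<theta>, s)" by (cases a)
  let ?L = "\<lambda>s z m. if m = p then s * lin v z else 0"
  have add: "approximable (\<lambda>z. z(P := (\<lambda>m. z P m + ?L s z m), T := (\<lambda>m. 0)))" for s
    using approximable_add_lin[OF p, of "\<lambda>a q. s * v a q"] unfolding lin_scale .
  have affine: "approximable (\<lambda>z. z(T := (\<lambda>m. if m \<in> box_of d then w * z P m + 0 * z P m + \<theta> else 0)))"
    by (rule approximable_update) (use PT in auto)
  let ?T = "\<lambda>z m. if m \<in> box_of d then \<sigma> (w * (z P m + ?L s z m) + \<theta>) else 0"
  have 1: "approximable (\<lambda>z. z(P := (\<lambda>m. z P m + ?L s z m), T := ?T z))"
  proof (rule approximable_comp[OF approximable_activation[OF PT(2)] approximable_comp[OF affine add]])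
    show "z(P := (\<lambda>m. z P m + ?L s z m), T := ?T z)
      = (z(P := (\<lambda>m. z P m + ?L s z m), T := (\<lambda>m. if m \<in> box_of d then w * (z P m + ?L s z m) + \<theta> else 0)))
          (T := (\<lambda>m. if m \<in> box_of d then \<sigma> ((z(P := (\<lambda>m. z P m + ?L s z m),
             T := (\<lambda>m. if m \<in> box_of d then w * (z P m + ?L s z m) + \<theta> else 0))) T m) else 0))" for z
      by (auto simp: fun_eq_iff)
  qed (use PT in \<open>auto simp: fun_eq_iff\<close>)
  have 2: "approximable (\<lambda>z. z(P := (\<lambda>m. z P m + ?L s z m + c * ?T z m), T := ?T z))"
    by (rule approximable_comp[OF approximable_add_multiple[OF PT(1,2), of c] 1])
      (use PT in \<open>auto simp: fun_eq_iff\<close>)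
  show ?thesis
  \<comment> \<open>The part with \<open>- s\<close> undoes the shift of the register:
    \<open>lin\<close> reads channels up to \<open>n\<close>, which are unchanged, so it has the
    same value as before.\<close>
  proof (rule approximable_comp[OF add[of "- s"] 2])
    fix z assume z: "z \<in> S"
    let ?z = "z(P := (\<lambda>m. z P m + ?L s z m + c * ?T z m), T := ?T z)"
    have lin: "lin v ?z = lin v z" using n by simp
    have overwrite: "z(P := A, T := B, P := A', T := B') = z(P := A', T := B')" for A B A' B'
      by (auto simp: fun_eq_iff)
    have "(\<lambda>m. if m \<in> box_of d then gate \<sigma> a (if m = p then lin v z else 0) (z P m) else 0)
        = (\<lambda>m. ?z P m + ?L (- s) ?z m)"
    proof
      fix m
      have "m \<notin> box_of d \<Longrightarrow> z P m = 0" using mtensorsD[OF z] by blast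
      then show "(if m \<in> box_of d then gate \<sigma> a (if m = p then lin v z else 0) (z P m) else 0)
          = ?z P m + ?L (- s) ?z m"
        unfolding lin using PT(3) p by (cases "m \<in> box_of d"; cases "m = p") (simp_all add: a)
    qed
    then show "z(P := (\<lambda>m. if m \<in> box_of d then gate \<sigma> a (if m = p then lin v z else 0) (z P m) else 0), T := (\<lambda>m. 0))
      = ?z(P := (\<lambda>m. ?z P m + ?L (- s) ?z m), T := (\<lambda>m. 0))"
      by (simp only: overwrite)
  qed
qed

lemma approximable_gates:
  assumes p: "p \<in> box_of d"
  shows "approximable (\<lambda>z. z(P := (\<lambda>m. if m \<in> box_of d then gates \<sigma> as (if m = p then lin v z else 0) (z P m) else 0),
    T := (\<lambda>m. 0)))"
proof (induction as)
  case Nil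
  show ?case
  proof (rule approximable_cong[OF approximable_clear[OF PT(2)]])
    fix z assume z: "z \<in> S"
    have "z P m = 0" if "m \<notin> box_of d" for m using mtensorsD[OF z] that by blast
    then show "z(P := (\<lambda>m. if m \<in> box_of d then gates \<sigma> [] (if m = p then lin v z else 0) (z P m) else 0), T := (\<lambda>m. 0))
      = z(T := (\<lambda>m. 0))" by (simp add: fun_eq_iff)
  qed
next
  case (Cons a as)
  show ?case
    by (rule approximable_comp[OF Cons approximable_gate[OF p, of a v]]) (use PT(3) n in \<open>auto simp: fun_eq_iff\<close>)
qed

lemma lin_bound:
  assumes "bounded_by R z"
  shows "\<bar>lin v z\<bar> \<le> (\<Sum>(a, q)\<in>{1..n} \<times> box_of d. \<bar>v a q\<bar>) * R"
  unfolding lin_def sum_distrib_right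
  using bounded_byD[OF assms]
  by (intro order_trans[OF sum_abs] sum_mono) (auto simp: abs_mult intro!: mult_left_mono)

text \<open>Setting the register to 1 turns suitable gates into approximate exponentials. Positions
  other than \<open>p\<close> run with parameter 0 and so end at 1 instead of 0; the entry at
  \<open>p\<close> has yet to be isolated.\<close>

lemma approximable_exp:
  assumes p: "p \<in> box_of d"
  shows "approximable (\<lambda>z. z(P := (\<lambda>m. if m \<in> box_of d then exp (if m = p then lin v z else 0) else 0), T := (\<lambda>m. 0)))"
proof (rule approximable_limit)
  fix R e :: real assume "0 < e"
  define M where "M = (\<Sum>(a, q)\<in>{1..n} \<times> box_of d. \<bar>v a q\<bar>)"
  have M: "0 \<le> M" by (auto simp: M_def intro: sum_nonneg)
  \<comment> \<open>The radius must be positive while \<open>R\<close> is an arbitrary real, hence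
    \<open>\<bar>R\<bar>\<close> and the summand 1.\<close>
  obtain as where as: "\<And>l. \<bar>l\<bar> \<le> M * \<bar>R\<bar> + 1 \<Longrightarrow> \<bar>gates \<sigma> as l 1 - exp l\<bar> \<le> e"
    using gates_approximate_exp[OF cont nonaff _ \<open>0 < e\<close>, of "M * \<bar>R\<bar> + 1"] M
    by (metis add_nonneg_pos abs_ge_zero mult_nonneg_nonneg zero_less_one)
  have one: "approximable (\<lambda>z. z(P := (\<lambda>m. if m \<in> box_of d then 0 * z P m + 0 * z P m + 1 else 0)))"
    by (rule approximable_update) (use PT in auto)
  let ?F = "\<lambda>z. z(P := (\<lambda>m. if m \<in> box_of d then gates \<sigma> as (if m = p then lin v z else 0) 1 else 0), T := (\<lambda>m. 0))"
  have "approximable ?F"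
    by (rule approximable_comp[OF approximable_gates[OF p, of as v] one]) (use n in \<open>auto simp: fun_eq_iff\<close>)
  moreover have "bounded_by e (?F z - z(P := (\<lambda>m. if m \<in> box_of d then exp (if m = p then lin v z else 0) else 0), T := (\<lambda>m. 0)))"
    if z: "bounded_by R z" for z
  proof -
    have "M * R \<le> M * \<bar>R\<bar>" "0 \<le> M * \<bar>R\<bar>" using M by (auto intro: mult_left_mono)
    then have "\<bar>lin v z\<bar> \<le> M * \<bar>R\<bar> + 1" "\<bar>0\<bar> \<le> M * \<bar>R\<bar> + 1"
      using lin_bound[OF z, of v] unfolding M_def[symmetric] by linarith+
    from as[OF this(1)] as[OF this(2)] show ?thesis
      using \<open>0 < e\<close> by (auto simp: bounded_by_def fun_diff_def)
  qed
  ultimately show "\<exists>T'. approximable T' \<and> (\<forall>z\<in>S. bounded_by R z \<longrightarrow> bounded_by e (T' z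
      - z(P := (\<lambda>m. if m \<in> box_of d then exp (if m = p then lin v z else 0) else 0), T := (\<lambda>m. 0))))"
    by blast
qed

text \<open>Adding only the entry at \<open>p\<close> of the register discards the ones left at the
  other positions.\<close>

lemma approximable_add_exp:
  assumes p: "p \<in> box_of d" and b: "b \<in> {1..l}" "b \<noteq> P" "b \<noteq> T"
  shows "approximable (\<lambda>z. z(b := (\<lambda>m. z b m + (if m = p then c * exp (lin v z) else 0)), P := (\<lambda>m. 0), T := (\<lambda>m. 0)))"
proof (rule approximable_comp[OF approximable_clear[OF PT(1)]
      approximable_comp[OF approximable_add_entry[OF PT(1) b(1,3) p p] approximable_exp[OF p]]])
  show "z(b := (\<lambda>m. z b m + (if m = p then c * exp (lin v z) else 0)), P := (\<lambda>m. 0), T := (\<lambda>m. 0))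
    = (z(P := (\<lambda>m. if m \<in> box_of d then exp (if m = p then lin v z else 0) else 0),
         b := (\<lambda>m. z b m + (if m = p then c * exp (lin v z) else 0)), T := (\<lambda>m. 0)))(P := (\<lambda>m. 0))" for z
    using b PT(3) by (auto simp: fun_eq_iff)
qed (use p b PT(3) in \<open>auto simp: fun_eq_iff\<close>)

inductive_set exp_sums :: "('n mtensor \<Rightarrow> real) set" where
  exp: "(\<lambda>z. c * exp (lin v z)) \<in> exp_sums"
| add: "f \<in> exp_sums \<Longrightarrow> g \<in> exp_sums \<Longrightarrow> (\<lambda>z. f z + g z) \<in> exp_sums"

lemma exp_sums_cong: "f \<in> exp_sums \<Longrightarrow> (\<And>a. a \<le> n \<Longrightarrow> z a = z' a) \<Longrightarrow> f z = f z'"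
  by (induction rule: exp_sums.induct) (auto cong: lin_cong)

lemma exp_sums_update: "f \<in> exp_sums \<Longrightarrow> n < ch \<Longrightarrow> f (z(ch := t)) = f z"
  by (erule exp_sums_cong) simp

lemma approximable_add_exp_sum:
  assumes p: "p \<in> box_of d" and b: "b \<in> {1..l}" "b \<noteq> P" "b \<noteq> T" "n < b" and g: "g \<in> exp_sums"
  shows "approximable (\<lambda>z. z(b := (\<lambda>m. z b m + (if m = p then g z else 0)), P := (\<lambda>m. 0), T := (\<lambda>m. 0)))"
  using g
proof (induction rule: exp_sums.induct)
  case (exp c v)
  show ?case by (rule approximable_add_exp[OF p b(1-3)])
next
  case (add f g)
  show ?case
    by (rule approximable_comp[OF add.IH]) (use b n PT(3) in \<open>auto simp: fun_eq_iff exp_sums_update[OF add.hyps(1)] exp_sums_update[OF add.hyps(2)]\<close>)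
qed

text \<open>The entries are treated one after the other. Writing to channels above \<open>n\<close>
  leaves the input intact, so every \<open>g b p\<close> is evaluated at the same input.\<close>

lemma approximable_add_exp_sums:
  assumes A: "finite A" "A \<subseteq> ({n<..l} - {P, T}) \<times> box_of d" and g: "\<And>b p. g b p \<in> exp_sums"
  shows "approximable (\<lambda>z b m. if b = P \<or> b = T then 0 else z b m + (if (b, m) \<in> A then g b m z else 0))"
  using A
proof (induction A)
  case empty
  show ?case
    by (rule approximable_comp[OF approximable_clear[OF PT(1)] approximable_clear[OF PT(2)]]) (auto simp: fun_eq_iff)
next
  case (insert x A)
  obtain b p where x: "x = (b, p)" by (cases x)
  then have b: "b \<in> {1..l}" "b \<noteq> P" "b \<noteq> T" "n < b" and p: "p \<in> box_of d" using insert.prems by auto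
  have IH: "approximable (\<lambda>z b m. if b = P \<or> b = T then 0 else z b m + (if (b, m) \<in> A then g b m z else 0))"
    using insert by blast
  show ?case
  proof (rule approximable_comp[OF IH approximable_add_exp_sum[OF p b g, of b p]])
    fix z
    let ?z = "z(b := (\<lambda>m. z b m + (if m = p then g b p z else 0)), P := (\<lambda>m. 0), T := (\<lambda>m. 0))"
    have gz: "g b' m ?z = g b' m z" for b' m
      using b n by (simp only: exp_sums_update[OF g])
    show "(\<lambda>b m. if b = P \<or> b = T then 0 else z b m + (if (b, m) \<in> insert x A then g b m z else 0))
      = (\<lambda>b m. if b = P \<or> b = T then 0 else ?z b m + (if (b, m) \<in> A then g b m ?z else 0))"
      unfolding gz using insert.hyps b by (intro ext) (auto simp: x)
  qed
qed

end

subsection \<open>Density\<close>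

lemma continuous_on_mtensor_coordinate:
  "continuous_on X f \<Longrightarrow> continuous_on X (\<lambda>x. f x j i :: real)" for f :: "'a::topological_space \<Rightarrow> 'n mtensor"
  by (rule continuous_on_product_then_coordinatewise[OF continuous_on_product_then_coordinatewise])

lemma continuous_on_mtensorI:
  fixes f :: "'a::topological_space \<Rightarrow> 'n mtensor"
  shows "(\<And>j i. continuous_on X (\<lambda>x. f x j i)) \<Longrightarrow> continuous_on X f"
  by (intro continuous_on_coordinatewise_then_product)

lemma continuous_on_conv_layer:
  assumes "C \<in> conv_layers d k c c'"
  shows "continuous_on UNIV C"
proof -
  obtain w \<delta> where C: "C = conv_layer d k c c' w \<delta>" using assms by (auto simp: conv_layers_def)
  have coord: "continuous_on UNIV (\<lambda>z :: 'a mtensor. z j i)" for j i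
    by (intro continuous_on_mtensor_coordinate continuous_on_id)
  have "continuous_on UNIV (\<lambda>z :: 'a mtensor. if i \<in> box_of d then z j i else 0)" for i j
    by (cases "i \<in> box_of d") (simp_all add: coord)
  then have "continuous_on UNIV (\<lambda>z :: 'a mtensor. conv d k v (z j) m)" for v j m
    unfolding conv_def by (cases "m \<in> box_of d") (auto intro!: continuous_intros)
  then have "continuous_on UNIV (\<lambda>z. C z i m)" for i m
    unfolding C conv_layer_def by (cases "i \<in> {1..c'}") (auto intro!: continuous_intros)
  then show ?thesis by (intro continuous_on_mtensorI)
qed

lemma continuous_on_act:
  assumes "continuous_on UNIV \<sigma>"
  shows "continuous_on UNIV (act \<sigma> d c)"
proof (rule continuous_on_mtensorI)
  fix j i
  have "continuous_on UNIV (\<lambda>z :: 'a mtensor. z j i)"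
    by (intro continuous_on_mtensor_coordinate continuous_on_id)
  then have "continuous_on UNIV (\<lambda>z :: 'a mtensor. \<sigma> (z j i))"
    by (intro continuous_on_compose2[OF assms]) auto
  then show "continuous_on UNIV (\<lambda>z. act \<sigma> d c z j i)"
    unfolding act_def by (cases "j \<in> {1..c} \<and> i \<in> box_of d") auto
qed

lemma continuous_on_compose_layers:
  assumes "continuous_on UNIV \<sigma>" "\<And>i. 1 \<le> i \<Longrightarrow> i \<le> n + 1 \<Longrightarrow> continuous_on UNIV (C i)"
  shows "continuous_on UNIV (compose_layers \<sigma> d b C n)"
  using assms(2)
proof (induction n)
  case (Suc n)
  have "continuous_on UNIV (compose_layers \<sigma> d b C n)" using Suc by simp
  then have "continuous_on UNIV (act \<sigma> d (b (n + 1)) \<circ> compose_layers \<sigma> d b C n)"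
    by (intro continuous_on_compose continuous_on_subset[OF continuous_on_act[OF assms(1)]]) auto
  moreover have "continuous_on UNIV (C (n + 2))" using Suc.prems[of "n + 2"] by simp
  ultimately show ?case
    unfolding compose_layers.simps comp_assoc by (metis continuous_on_compose continuous_on_subset subset_UNIV)
qed simp

lemma deep_cnns_continuous:
  assumes "f \<in> deep_cnns \<sigma> d k c c' l" "continuous_on UNIV \<sigma>"
  shows "continuous_on UNIV f"
proof -
  obtain N b C where f: "f = compose_layers \<sigma> d b C (N - 1)" "1 \<le> N"
    "\<forall>i\<in>{1..N}. C i \<in> conv_layers d k (b (i - 1)) (b i)"
    using assms(1) unfolding deep_cnns_def by blast
  have "continuous_on UNIV (C i)" if "1 \<le> i" "i \<le> N - 1 + 1" for i
  proof (rule continuous_on_conv_layer)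
    show "C i \<in> conv_layers d k (b (i - 1)) (b i)" using f(2,3) that by simp
  qed
  then show ?thesis
    unfolding f(1) by (rule continuous_on_compose_layers[OF assms(2)])
qed

lemma deep_cnns_in_mtensors:
  assumes "f \<in> deep_cnns \<sigma> d k c c' l"
  shows "f z \<in> mtensors c' d"
proof -
  obtain N b C where f: "f = compose_layers \<sigma> d b C (N - 1)" "1 \<le> N" "b N = c'"
    "\<forall>i\<in>{1..N}. C i \<in> conv_layers d k (b (i - 1)) (b i)"
    using assms unfolding deep_cnns_def by blast
  have "C N \<in> conv_layers d k (b (N - 1)) c'" using f by auto
  moreover have "\<exists>y. f z = C N y"
  proof (cases "N - 1")
    case 0
    then have "N = 1" using f(2) by simp
    then show ?thesis using f(1) by auto
  next
    case (Suc m)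
    then have "N = m + 2" by simp
    then show ?thesis using f(1) by auto
  qed
  ultimately show ?thesis using conv_layer_in_mtensors by metis
qed

context register_net
begin

lemma continuous_on_lin: "continuous_on X (lin v)"
  unfolding lin_def split_def
  by (intro continuous_on_sum continuous_on_mult_left continuous_on_mtensor_coordinate continuous_on_id)

lemma exp_sums_continuous: "f \<in> exp_sums \<Longrightarrow> continuous_on X f"
proof (induction rule: exp_sums.induct)
  case (exp c v)
  show ?case by (intro continuous_on_mult_left continuous_on_exp continuous_on_lin)
next
  case (add f g)
  then show ?case by (intro continuous_on_add)
qed

lemma lin_add: "lin (\<lambda>a q. v a q + v' a q) z = lin v z + lin v' z"
  by (simp add: lin_def split_def distrib_right sum.distrib)

text \<open>The exponential law provides the products for Stone-Weierstrass without any
  multiplication by the network.\<close>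

lemma exp_sums_mult:
  assumes "f \<in> exp_sums" "g \<in> exp_sums"
  shows "(\<lambda>z. f z * g z) \<in> exp_sums"
  using assms(1)
proof (induction rule: exp_sums.induct)
  case (exp c v)
  show ?case using assms(2)
  proof (induction rule: exp_sums.induct)
    case (exp c' v')
    have "(\<lambda>z. c * exp (lin v z) * (c' * exp (lin v' z))) = (\<lambda>z. (c * c') * exp (lin (\<lambda>a q. v a q + v' a q) z))"
      by (simp add: lin_add exp_add mult_ac)
    then show ?case by (simp only: exp_sums.exp)
  next
    case (add f g)
    then show ?case by (simp only: distrib_left exp_sums.add)
  qed
next
  case (add f g)
  then show ?case by (simp only: distrib_right exp_sums.add)
qed

lemma exp_sums_dense:
  assumes K: "compact K" "K \<subseteq> mtensors n d" and f: "continuous_on K f" and e: "0 < e"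
  shows "\<exists>g\<in>exp_sums. \<forall>x\<in>K. \<bar>f x - g x\<bar> < e"
proof -
  interpret function_ring_on exp_sums K
  proof
    show "compact K" by fact
    show "continuous_on K f" if "f \<in> exp_sums" for f using that by (rule exp_sums_continuous)
    show "(\<lambda>_. c) \<in> exp_sums" for c
      using exp_sums.exp[of c "\<lambda>_ _. 0"] by (simp add: lin_def)
    fix x y assume xy: "x \<in> K" "y \<in> K" "x \<noteq> y"
    then obtain a q where aq: "x a q \<noteq> y a q" by (meson ext)
    then have mem: "(a, q) \<in> {1..n} \<times> box_of d"
      using xy K(2) mtensorsD[of _ n d a q] by (metis SigmaI subsetD)
    \<comment> \<open>The linear form that reads off one entry at which \<open>x\<close> and
      \<open>y\<close> differ; that entry is in the box because both vanish elsewhere.\<close>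
    define v :: "nat \<Rightarrow> 'n index \<Rightarrow> real" where "v = (\<lambda>b r. if (b, r) = (a, q) then 1 else 0)"
    have "lin v z = z a q" for z
    proof -
      have "lin v z = (\<Sum>x\<in>{1..n} \<times> box_of d. if x = (a, q) then z a q else 0)"
        unfolding lin_def v_def by (intro sum.cong) (auto split: if_splits)
      then show ?thesis using mem by simp
    qed
    then have "1 * exp (lin v x) \<noteq> 1 * exp (lin v y)" using aq by simp
    then show "\<exists>f\<in>exp_sums. f x \<noteq> f y" by (intro bexI[OF _ exp_sums.exp])
  qed (auto intro: exp_sums.add exp_sums_mult)
  show ?thesis by (rule Stone_Weierstrass_basic[OF f e])
qed

lemma deep_cnns_dense:
  assumes K: "compact K" "K \<subseteq> mtensors n d" and f: "continuous_on K f"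
    and c: "{n<..n + c} \<subseteq> {n<..l} - {P, T}" and e: "0 < e"
  shows "\<exists>F\<in>deep_cnns \<sigma> d k n c l. \<forall>x\<in>K. \<forall>j\<in>{1..c}. \<forall>i\<in>box_of d. \<bar>f x j i - F x j i\<bar> \<le> e"
proof -
  have l: "n \<le> l" "1 \<le> l" using n PT by auto
  \<comment> \<open>Output channel \<open>j\<close> is built up in network channel
    \<open>n + j\<close>, hence the index \<open>b - n\<close>.\<close>
  have "\<forall>b p. \<exists>g\<in>exp_sums. \<forall>x\<in>K. \<bar>f x (b - n) p - g x\<bar> < e / 2"
    using e by (intro allI exp_sums_dense K continuous_on_mtensor_coordinate f) simp
  then obtain g where g: "\<And>b p. g b p \<in> exp_sums" "\<And>b p x. x \<in> K \<Longrightarrow> \<bar>f x (b - n) p - g b p x\<bar> < e / 2"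
    by metis
  let ?A = "{n<..n + c} \<times> box_of d"
  define U where "U z b m = (if b = P \<or> b = T then 0 else z b m + (if (b, m) \<in> ?A then g b m z else 0))" for z b m
  have U: "approximable U"
    unfolding U_def using c by (intro approximable_add_exp_sums g(1)) auto
  \<comment> \<open>The first layer widens the input to \<open>l\<close> channels. With zeros off
    the channels it is the identity on \<open>mtensors n d\<close>, so the accumulating channels
    start at 0.\<close>
  define E where "E = pointwise_layer d k n l (\<lambda>i j. if j = i then 1 else 0) (\<lambda>_. 0)"
  have E_apply: "E x i m = x i m" if "x \<in> mtensors n d" for x i m
  proof (cases "i \<in> {1..n} \<and> m \<in> box_of d")
    case True
    then show ?thesis using l by (simp add: E_def pointwise_layer_apply if_distrib[of "\<lambda>x. x * _"] cong: if_cong)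
  next
    case False
    then have "x i m = 0" by (rule mtensorsD[OF that])
    then show ?thesis using False
      by (auto simp: E_def pointwise_layer_apply if_distrib[of "\<lambda>x. x * _"] cong: if_cong)
  qed
  then have E: "E x = x" if "x \<in> mtensors n d" for x using that by (intro ext)
  have "bounded ((\<lambda>x. \<Sum>(j, i)\<in>{1..n} \<times> box_of d. \<bar>x j i\<bar>) ` K)"
    unfolding split_def
    by (intro compact_imp_bounded compact_continuous_image K continuous_on_sum continuous_on_rabs
        continuous_on_mtensor_coordinate continuous_on_id)
  then obtain R where R: "\<And>x. x \<in> K \<Longrightarrow> \<bar>\<Sum>(j, i)\<in>{1..n} \<times> box_of d. \<bar>x j i\<bar>\<bar> \<le> R"
    unfolding bounded_iff by auto
  have KR: "bounded_by R x" if "x \<in> K" for x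
    using mtensors_bounded_by[of x n d] R[OF that] K(2) that by (meson abs_le_D1 bounded_by_mono subsetD)
  have "0 < e / 2" using e by simp
  then obtain F where F: "F \<in> extensions" "\<And>z. z \<in> S \<Longrightarrow> bounded_by R z \<Longrightarrow> bounded_by (e / 2) (F z - U z)"
    using approximableD[OF U, of "e / 2" R] by metis
  define Q where "Q = pointwise_layer d k l c (\<lambda>i j. if j = n + i then 1 else 0) (\<lambda>_. 0)"
  have "E \<in> deep_cnns \<sigma> d k n l l"
    unfolding E_def by (intro deep_cnns_conv_layer pointwise_layer_in_conv_layers)
  then have net: "Q \<circ> (F \<circ> E) \<in> deep_cnns \<sigma> d k n c l"
    unfolding Q_def by (intro deep_cnns_pointwise extensions_deep_cnns F(1) l)
  have "\<bar>f x j i - (Q \<circ> (F \<circ> E)) x j i\<bar> \<le> e" if x: "x \<in> K" and j: "j \<in> {1..c}" and i: "i \<in> box_of d" for x j i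
  proof -
    have xn: "x \<in> mtensors n d" using x K(2) by auto
    have xS: "x \<in> S" using conv_layer_in_mtensors[of E d k n l x] E[OF xn] by (simp add: E_def)
    have "n + j \<in> {n<..n + c}" using j by auto
    then have "n + j \<in> {n<..l} - {P, T}" using c by blast
    then have nj: "n + j \<in> {1..l}" "n + j \<noteq> P" "n + j \<noteq> T" by auto
    have "(Q \<circ> (F \<circ> E)) x j i = F x (n + j) i"
      using i j nj(1) E[OF xn] by (simp add: Q_def pointwise_layer_apply if_distrib[of "\<lambda>x. x * _"] cong: if_cong)
    moreover have "U x (n + j) i = g (n + j) i x"
      using nj i j mtensorsD[OF xn, of "n + j" i] by (simp add: U_def)
    moreover have "\<bar>F x (n + j) i - U x (n + j) i\<bar> \<le> e / 2"
      using bounded_byD[OF F(2)[OF xS KR[OF x]], of "n + j" i] by (simp add: fun_diff_def)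
    moreover have "\<bar>f x j i - g (n + j) i x\<bar> < e / 2" using g(2)[OF x, of "n + j" i] by simp
    ultimately show ?thesis by linarith
  qed
  then show ?thesis using net by blast
qed

end

text \<open>\<open>cfunspace\<close> consists of bounded continuous functions, and compactness of
  \<open>K\<close> makes boundedness automatic.\<close>

lemma mspace_cfunspace_mtensors:
  assumes "compact K"
  shows "mspace (cfunspace (top_of_set K) (mtensor_metric c d)) = cont_funs K (mtensors c d)"
proof -
  have "Metric_space.mbounded (mtensors c d) (mdist (mtensor_metric c d)) (f ` K)"
    if "continuous_on K f" "f \<in> K \<rightarrow> mtensors c d" for f
  proof -
    have "compact (f ` K)" by (rule compact_continuous_image[OF that(1) assms])
    moreover have "f ` K \<subseteq> mtensors c d" using that(2) by blast
    ultimately have "compactin (mtopology_of (mtensor_metric c d)) (f ` K)"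
      by (simp add: mtopology_of_mtensor_metric compactin_subtopology)
    then show ?thesis
      using Metric_space.compactin_imp_mbounded[OF Metric_space_mspace_mdist, of "mtensor_metric c d"]
      by (simp add: mtopology_of_def)
  qed
  then show ?thesis
    by (auto simp: cont_funs_def PiE_def mtopology_of_mtensor_metric)
qed

theorem theorem27:
  fixes d k :: "nat ^ 'n::finite"
    and c\<^sub>1 c\<^sub>2 :: nat
    and K :: "'n mtensor set"
    and \<sigma> :: "real \<Rightarrow> real"
  assumes "\<forall>t. 1 \<le> d $ t"
    and "1 \<le> c\<^sub>1" and "1 \<le> c\<^sub>2"
    and "K \<subseteq> mtensors c\<^sub>1 d" and "compact K"
    and "\<forall>t. 3 \<le> 2 * k $ t + 1"
    and "continuous_on UNIV \<sigma>"
    and "\<not> (\<exists>a b. \<forall>x. \<sigma> x = a * x + b)"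
    and "\<exists>\<alpha> \<epsilon>. 0 < \<epsilon> \<and> \<sigma> C1_differentiable_on {\<alpha> - \<epsilon><..<\<alpha> + \<epsilon>} \<and> deriv \<sigma> \<alpha> \<noteq> 0"
  shows "uniform_closure K c\<^sub>2 d (deep_cnns \<sigma> d k c\<^sub>1 c\<^sub>2 (c\<^sub>1 + c\<^sub>2 + 2)) = cont_funs K (mtensors c\<^sub>2 d)"
proof -
  obtain \<alpha> \<epsilon> where \<alpha>: "0 < \<epsilon>" "\<sigma> C1_differentiable_on {\<alpha> - \<epsilon><..<\<alpha> + \<epsilon>}" "deriv \<sigma> \<alpha> \<noteq> 0"
    using assms(9) by blast
  then obtain \<sigma>' where "\<forall>x\<in>{\<alpha> - \<epsilon><..<\<alpha> + \<epsilon>}. (\<sigma> has_vector_derivative \<sigma>' x) (at x)"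
    unfolding C1_differentiable_on_def by blast
  moreover have "\<alpha> \<in> {\<alpha> - \<epsilon><..<\<alpha> + \<epsilon>}" using \<alpha>(1) by simp
  ultimately have D: "(\<sigma> has_field_derivative \<sigma>' \<alpha>) (at \<alpha>)"
    unfolding has_real_derivative_iff_has_vector_derivative by (rule bspec)
  define l where "l = c\<^sub>1 + c\<^sub>2 + 2"
  \<comment> \<open>The input occupies channels \<open>1\<close> to \<open>c\<^sub>1\<close>, the
    output the next \<open>c\<^sub>2\<close>, and register and scratch channel the last two; this
    accounts for the width.\<close>
  interpret register_net d k \<sigma> \<alpha> "\<sigma>' \<alpha>" l "c\<^sub>1 + c\<^sub>2 + 1" "c\<^sub>1 + c\<^sub>2 + 2" c\<^sub>1
  proof
    show "1 \<le> k $ t" for t using assms(6)[rule_format, of t] by simp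
    show "\<sigma>' \<alpha> \<noteq> 0" using \<alpha>(3) DERIV_imp_deriv[OF D] by simp
  qed (use assms D in \<open>auto simp: l_def\<close>)
  let ?N = "deep_cnns \<sigma> d k c\<^sub>1 c\<^sub>2 l"
  let ?M = "cfunspace (top_of_set K) (mtensor_metric c\<^sub>2 d)"
  note M = mspace_cfunspace_mtensors[OF \<open>compact K\<close>, of c\<^sub>2 d]
  have net: "restrict F K \<in> mspace ?M" if "F \<in> ?N" for F
  proof -
    have "continuous_on K (restrict F K)"
      using continuous_on_subset[OF deep_cnns_continuous[OF that cont], of K]
      by (rule continuous_on_eq) auto
    then show ?thesis
      unfolding M cont_funs_def using deep_cnns_in_mtensors[OF that] by auto
  qed
  have "\<exists>F\<in>?N. mdist ?M f (restrict F K) \<le> r" if f: "f \<in> mspace ?M" and "0 < r" for f r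
  proof -
    have "continuous_on K f" using f unfolding M cont_funs_def by blast
    then obtain F where F: "F \<in> ?N" "\<And>x j i. x \<in> K \<Longrightarrow> j \<in> {1..c\<^sub>2} \<Longrightarrow> i \<in> box_of d \<Longrightarrow> \<bar>f x j i - F x j i\<bar> \<le> r"
      using deep_cnns_dense[OF \<open>compact K\<close> \<open>K \<subseteq> mtensors c\<^sub>1 d\<close>, of f c\<^sub>2 r] \<open>0 < r\<close> by (force simp: l_def)
    have "mdist ?M f (restrict F K) \<le> r"
    \<comment> \<open>The bound on the supremum is for nonempty \<open>K\<close>; for empty
      \<open>K\<close> both functions are the same extensional function.\<close>
    proof (cases "K = {}")
      case True
      then have "f = restrict F K" using f unfolding M cont_funs_def by (auto simp: fun_eq_iff)
      then show ?thesis using f \<open>0 < r\<close> by (metis less_imp_le mdist_zero)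
    next
      case False
      then show ?thesis
        using F \<open>0 < r\<close> by (subst cfunspace_mdist_le[OF f net[OF F(1)]]) (auto simp: max_norm_le_iff)
    qed
    then show ?thesis using F(1) by blast
  qed
  \<comment> \<open>The closure is described by closed balls, so a nonstrict bound for every
    positive \<open>r\<close> is enough.\<close>
  then have "mspace ?M \<subseteq> mtopology_of ?M closure_of ((\<lambda>f. restrict f K) ` ?N)"
    unfolding mtopology_of_def Metric_space.metric_closure_of_alt[OF Metric_space_mspace_mdist]
      Metric_space.in_mcball[OF Metric_space_mspace_mdist]
    using net by blast
  moreover have "mtopology_of ?M closure_of ((\<lambda>f. restrict f K) ` ?N) \<subseteq> mspace ?M"
    using closure_of_subset_topspace[of "mtopology_of ?M"] by simp
  ultimately show ?thesis unfolding uniform_closure_def M l_def by blast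
qed

end
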